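(* Let $(u,v)$ be local coordinates on a domain of a Riemannian surface with metric $g$ such that every coordinate rectangle $[u_1,u_2]\times[v_1,v_2]$ in the domain has the Ivory property (its two geodesic diagonals, joining $(u_1,v_1)$ to $(u_2,v_2)$ and $(u_1,v_2)$ to $(u_2,v_1)$, have equal length). Then, near every point, the metric is Liouville in these coordinates: $g=(U_1(u)-V_1(v))(U_2(u)\,du^2+V_2(v)\,dv^2)$ for some functions $U_1,U_2$ of $u$ and $V_1,V_2$ of $v$.
   Context: Geodesic diagonals are the (short, locally unique) geodesic segments joining opposite corners of a small coordinate rectangle. *)

theory Defs
  imports "HOL-Analysis.Analysis"
begin

text \<open>Points of the coordinate domain are pairs (u,v) :: real \<times> real.
  A Riemannian metric on a domain is given by its coefficients
  g = E du^2 + 2 F du dv + G dv^2.\<close>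

type_synonym pt = "real \<times> real"

definition pdiff :: "nat \<Rightarrow> (pt \<Rightarrow> real) \<Rightarrow> pt \<Rightarrow> real" where
  "pdiff i f p = frechet_derivative f (at p) (if i = 0 then (1, 0) else (0, 1))"

fun Ck_on :: "nat \<Rightarrow> pt set \<Rightarrow> (pt \<Rightarrow> real) \<Rightarrow> bool" where
  "Ck_on 0 S f = continuous_on S f"
| "Ck_on (Suc k) S f =
     (f differentiable_on S \<and> Ck_on k S (pdiff 0 f) \<and> Ck_on k S (pdiff 1 f))"

definition smooth_fun_on :: "pt set \<Rightarrow> (pt \<Rightarrow> real) \<Rightarrow> bool" where
  "smooth_fun_on S f \<longleftrightarrow> (\<forall>k. Ck_on k S f)"

definition comp :: "nat \<Rightarrow> pt \<Rightarrow> real" where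
  "comp i x = (if i = 0 then fst x else snd x)"

definition gmat :: "(pt \<Rightarrow> real) \<Rightarrow> (pt \<Rightarrow> real) \<Rightarrow> (pt \<Rightarrow> real) \<Rightarrow> nat \<Rightarrow> nat \<Rightarrow> pt \<Rightarrow> real" where
  "gmat E F G i j = (if i = 0 \<and> j = 0 then E else if i = 1 \<and> j = 1 then G else F)"

definition christ1 :: "(pt \<Rightarrow> real) \<Rightarrow> (pt \<Rightarrow> real) \<Rightarrow> (pt \<Rightarrow> real) \<Rightarrow> nat \<Rightarrow> nat \<Rightarrow> nat \<Rightarrow> pt \<Rightarrow> real" where
  "christ1 E F G k i j p =
     (pdiff i (gmat E F G j k) p + pdiff j (gmat E F G i k) p - pdiff k (gmat E F G i j) p) / 2"

text \<open>A geodesic segment parametrised by [0,1]: a C^2 curve satisfying the geodesic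
  equations g_kl x''^l + Gamma_{k,ij} x'^i x'^j = 0 (indices lowered with the
  invertible metric, equivalent to the usual form with Christoffel symbols of the
  second kind).\<close>
definition geodesic :: "(pt \<Rightarrow> real) \<Rightarrow> (pt \<Rightarrow> real) \<Rightarrow> (pt \<Rightarrow> real) \<Rightarrow> (real \<Rightarrow> pt) \<Rightarrow> bool" where
  "geodesic E F G \<gamma> \<longleftrightarrow>
     (\<exists>\<gamma>' \<gamma>''. continuous_on {0..1} \<gamma>'' \<and>
        (\<forall>t\<in>{0..1}.
          (\<gamma> has_vector_derivative \<gamma>' t) (at t within {0..1}) \<and>
          (\<gamma>' has_vector_derivative \<gamma>'' t) (at t within {0..1}) \<and>
          (\<forall>k<2. (\<Sum>l<2. gmat E F G k l (\<gamma> t) * comp l (\<gamma>'' t))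
                 + (\<Sum>i<2. \<Sum>j<2. christ1 E F G k i j (\<gamma> t) * comp i (\<gamma>' t) * comp j (\<gamma>' t))
                 = 0)))"

definition curve_length :: "(pt \<Rightarrow> real) \<Rightarrow> (pt \<Rightarrow> real) \<Rightarrow> (pt \<Rightarrow> real) \<Rightarrow> (real \<Rightarrow> pt) \<Rightarrow> real" where
  "curve_length E F G \<gamma> =
     integral {0..1} (\<lambda>t. let w = vector_derivative \<gamma> (at t within {0..1}) in
        sqrt (E (\<gamma> t) * (fst w)^2 + 2 * F (\<gamma> t) * fst w * snd w + G (\<gamma> t) * (snd w)^2))"

end

theory Submission
  imports Defs
begin

text \<open>Short geodesics between nearby points exist and depend Lipschitz continuously on their endpoints, so
  the first variation formula computes the gradient of their energy (the squared length) \<open>S\<close>. Comparing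
  leading terms for the two diagonals of a small square gives \<open>F = 0\<close>. Differentiating
  the Ivory identity in each of \<open>u1, u2, v1, v2\<close> shows that the momenta of the two diagonals agree up to
  sign: the squared \<open>u\<close>-momentum depends only on the side \<open>u = u1\<close> or \<open>u = u2\<close> (values \<open>a, b\<close>) and the
  squared \<open>v\<close>-momentum only on the side \<open>v = v1\<close> or \<open>v = v2\<close> (values \<open>c, d\<close>). Conservation of energy at the four
  corners gives four linear equations in \<open>a, b, c, d\<close>; with \<open>\<rho> = E / G\<close>, eliminating \<open>a, b, c\<close> leaves
  \<open>d (\<rho>11 \<rho>22 - \<rho>12 \<rho>21) = S (\<rho>11 (E22 - E21) - \<rho>21 (E12 - E11))\<close>. In the limit of a rectangle with
  sides \<open>\<alpha> s\<close> and \<open>s\<close> shrinking to a point this reads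
  \<open>G\<^sup>2 (\<rho> \<rho>uv - \<rho>u \<rho>v) = (E \<alpha>\<^sup>2 + G) (\<rho> Euv - \<rho>u Ev)\<close>, and since \<open>\<alpha>\<close> is arbitrary both
  brackets vanish. These two equations integrate to the Liouville form.\<close>

subsection \<open>Two-point boundary value problems\<close>

definition primitive :: "(real \<Rightarrow> 'a::banach) \<Rightarrow> real \<Rightarrow> 'a" where
  "primitive z t = integral {0..t} z"

text \<open>Velocity and position of the curve on \<open>[0,1]\<close> from \<open>a\<close> to \<open>b\<close> with acceleration \<open>z\<close>; the boundary
  value problem becomes a fixed point equation for \<open>z\<close>.\<close>

definition bvp_vel :: "'a::banach \<Rightarrow> 'a \<Rightarrow> (real \<Rightarrow> 'a) \<Rightarrow> real \<Rightarrow> 'a" where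
  "bvp_vel a b z t = (b - a - primitive (primitive z) 1) + primitive z t"

definition bvp_pos :: "'a::banach \<Rightarrow> 'a \<Rightarrow> (real \<Rightarrow> 'a) \<Rightarrow> real \<Rightarrow> 'a" where
  "bvp_pos a b z t = a + t *\<^sub>R (b - a - primitive (primitive z) 1) + primitive (primitive z) t"

lemma primitive_has_vector_derivative:
  assumes "continuous_on {0..1} z" "t \<in> {0..1}"
  shows "(primitive z has_vector_derivative z t) (at t within {0..1})"
  using integral_has_vector_derivative[OF assms] unfolding primitive_def .

lemma continuous_on_primitive:
  assumes "continuous_on {0..1} z"
  shows "continuous_on {0..1} (primitive z)"
  by (rule continuous_on_vector_derivative, rule primitive_has_vector_derivative[OF assms])

lemma primitive_dist_le:
  assumes "continuous_on {0..1} z" "continuous_on {0..1} y"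
    and d: "\<And>s. s \<in> {0..1} \<Longrightarrow> norm (z s - y s) \<le> d" and t: "t \<in> {0..1}"
  shows "norm (primitive z t - primitive y t) \<le> d"
proof -
  have sub: "{0..t} \<subseteq> {0..1}" using t by auto
  have int: "z integrable_on {0..t}" "y integrable_on {0..t}"
    using assms sub by (auto intro!: integrable_continuous_real intro: continuous_on_subset)
  have "0 \<le> d" using d[of 0] norm_ge_zero[of "z 0 - y 0"] by (simp del: norm_ge_zero)
  have "primitive z t - primitive y t = integral {0..t} (\<lambda>s. z s - y s)"
    unfolding primitive_def by (simp add: integral_diff int)
  also have "norm \<dots> \<le> integral {0..t} (\<lambda>_. d)"
    by (rule integral_norm_bound_integral) (use int sub d in \<open>auto intro: integrable_diff\<close>)
  also have "\<dots> = t * d" using t by simp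
  also have "\<dots> \<le> d" using t \<open>0 \<le> d\<close> by (simp add: mult_left_le_one_le)
  finally show ?thesis .
qed

text \<open>Integration over a subinterval of \<open>{0..1}\<close> does not increase sup norms. One
  \<open>d\<close> comes from the running primitive, the other from the correction that forces the
  endpoint; the endpoint differences enter the position with weights \<open>1 - t\<close> and
  \<open>t\<close>.\<close>

lemma bvp_dist_le:
  assumes "continuous_on {0..1} z" "continuous_on {0..1} y"
    and d: "\<And>s. s \<in> {0..1} \<Longrightarrow> norm (z s - y s) \<le> d" and t: "t \<in> {0..1}"
  shows "norm (bvp_vel a b z t - bvp_vel a' b' y t) \<le> norm (a - a') + norm (b - b') + 2 * d"
    and "norm (bvp_pos a b z t - bvp_pos a' b' y t) \<le> norm (a - a') + norm (b - b') + 2 * d"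
proof -
  have 1: "norm (primitive z s - primitive y s) \<le> d" if "s \<in> {0..1}" for s
    using primitive_dist_le[OF assms(1,2) d that] .
  have 2: "norm (primitive (primitive z) s - primitive (primitive y) s) \<le> d" if "s \<in> {0..1}" for s
    by (intro primitive_dist_le continuous_on_primitive assms 1 that)
  let ?e = "primitive (primitive z) 1 - primitive (primitive y) 1"
  have e: "norm ?e \<le> d" by (rule 2) simp
  have "bvp_vel a b z t - bvp_vel a' b' y t
    = (b - b') - (a - a') - ?e + (primitive z t - primitive y t)"
    by (simp add: bvp_vel_def)
  also have "norm \<dots> \<le> norm (b - b') + norm (a - a') + norm ?e + norm (primitive z t - primitive y t)"
    by (intro norm_triangle_mono norm_triangle_le_diff order_refl add_mono)
  finally show "norm (bvp_vel a b z t - bvp_vel a' b' y t) \<le> norm (a - a') + norm (b - b') + 2 * d"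
    using e 1[OF t] by linarith
  have "bvp_pos a b z t - bvp_pos a' b' y t
    = (1 - t) *\<^sub>R (a - a') + t *\<^sub>R (b - b') - t *\<^sub>R ?e
      + (primitive (primitive z) t - primitive (primitive y) t)"
    by (simp add: bvp_pos_def algebra_simps)
  also have "norm \<dots> \<le> norm ((1 - t) *\<^sub>R (a - a')) + norm (t *\<^sub>R (b - b')) + norm (t *\<^sub>R ?e)
      + norm (primitive (primitive z) t - primitive (primitive y) t)"
    by (intro norm_triangle_mono norm_triangle_le_diff order_refl add_mono)
  also have "\<dots> \<le> norm (a - a') + norm (b - b') + norm ?e + d"
    using t 2[OF t] by (intro add_mono) (auto simp: mult_left_le_one_le)
  finally show "norm (bvp_pos a b z t - bvp_pos a' b' y t) \<le> norm (a - a') + norm (b - b') + 2 * d"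
    using e by linarith
qed

lemma primitive_zero: "primitive (\<lambda>_. 0) = (\<lambda>_. 0)"
  by (simp add: primitive_def fun_eq_iff)

text \<open>Comparison with zero acceleration, whose curve is the straight chord from
  \<open>a\<close> to \<open>b\<close>.\<close>

lemma bvp_norm_le:
  assumes "continuous_on {0..1} z"
    and d: "\<And>s. s \<in> {0..1} \<Longrightarrow> norm (z s) \<le> d" and t: "t \<in> {0..1}"
  shows "norm (bvp_vel a b z t - (b - a)) \<le> 2 * d"
    and "norm (bvp_pos a b z t - (a + t *\<^sub>R (b - a))) \<le> 2 * d"
  using bvp_dist_le[OF assms(1) continuous_on_const[of _ 0] _ t, of d a b a b] d
  by (simp_all add: primitive_zero bvp_vel_def bvp_pos_def)

lemma bvp_endpoints: "bvp_pos a b z 0 = a" "bvp_pos a b z 1 = b"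
  by (simp_all add: bvp_pos_def primitive_def)

lemma bvp_has_vector_derivative:
  assumes "continuous_on {0..1} z" "t \<in> {0..1}"
  shows "(bvp_pos a b z has_vector_derivative bvp_vel a b z t) (at t within {0..1})"
    and "(bvp_vel a b z has_vector_derivative z t) (at t within {0..1})"
proof -
  show "(bvp_vel a b z has_vector_derivative z t) (at t within {0..1})"
    unfolding bvp_vel_def[abs_def]
    by (auto intro!: derivative_eq_intros primitive_has_vector_derivative assms)
  show "(bvp_pos a b z has_vector_derivative bvp_vel a b z t) (at t within {0..1})"
    unfolding bvp_pos_def[abs_def] bvp_vel_def
    by (rule derivative_eq_intros primitive_has_vector_derivative continuous_on_primitive assms refl)+
      simp
qed

text \<open>The equation \<open>x'' = f x x'\<close> with \<open>f\<close> behaving quadratically in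
  the velocity, as in the geodesic equation. The velocity bound \<open>r\<close> stays free: small
  velocities make both the size and the Lipschitz constant of the right-hand side small, which
  replaces the usual smallness of the time interval.\<close>

locale quadratic_ode =
  fixes p :: "'a::banach" and R C :: real and f :: "'a \<Rightarrow> 'a \<Rightarrow> 'a"
  assumes R: "R > 0" and C: "C > 0"
    and growth: "\<And>x v r. x \<in> ball p R \<Longrightarrow> norm v \<le> r \<Longrightarrow> norm (f x v) \<le> C * r\<^sup>2"
    and lip: "\<And>x y v w r. x \<in> ball p R \<Longrightarrow> y \<in> ball p R \<Longrightarrow> norm v \<le> r \<Longrightarrow> norm w \<le> r \<Longrightarrow>
        norm (f x v - f y w) \<le> C * (r\<^sup>2 * norm (x - y) + r * norm (v - w))"
begin

text \<open>Radius for the endpoints: \<open>4 * h \<le> R\<close> keeps the curves in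
  \<open>ball p R\<close>, \<open>h \<le> 1\<close> lets \<open>h\<close> dominate its square and
  bounds speeds by 4, and \<open>80 * (C * h) \<le> 1\<close> yields the contraction.\<close>

definition "h = min (min 1 (R / 4)) (1 / (80 * C))"

lemma h: "h > 0" "h \<le> 1" "4 * h \<le> R" "80 * (C * h) \<le> 1"
proof -
  show "h > 0" "h \<le> 1" "4 * h \<le> R" using R C by (auto simp: h_def)
  have "h \<le> 1 / (80 * C)" by (simp add: h_def)
  then show "80 * (C * h) \<le> 1" using C by (simp add: field_simps)
qed

text \<open>The chord contributes \<open>2 * h\<close> to the speed and an acceleration of size
  \<open>h\<close> another \<open>2 * h\<close>. The chord itself stays in \<open>ball p h\<close>,
  so the curve stays within \<open>3 * h\<close> of \<open>p\<close>.\<close>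

lemma bounds:
  assumes a: "a \<in> ball p h" and b: "b \<in> ball p h" and z: "continuous_on {0..1} z"
    and zh: "\<And>s. s \<in> {0..1} \<Longrightarrow> norm (z s) \<le> h" and t: "t \<in> {0..1}"
  shows "bvp_pos a b z t \<in> ball p R" "norm (bvp_vel a b z t) \<le> 4 * h"
proof -
  have ab: "norm (b - a) \<le> 2 * h"
    using a b dist_triangle[of b a p] by (auto simp: dist_norm norm_minus_commute)
  show "norm (bvp_vel a b z t) \<le> 4 * h"
    using bvp_norm_le(1)[OF z zh t, of a b] ab norm_triangle_ineq2[of "bvp_vel a b z t" "b - a"] by linarith
  have "a + t *\<^sub>R (b - a) \<in> ball p h"
    using convexD_alt[OF convex_ball a b, of t] t by (simp add: algebra_simps)
  then have "dist p (a + t *\<^sub>R (b - a)) < h" by simp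
  moreover have "dist (bvp_pos a b z t) (a + t *\<^sub>R (b - a)) \<le> 2 * h"
    using bvp_norm_le(2)[OF z zh t, of a b] by (simp add: dist_norm)
  ultimately have "dist p (bvp_pos a b z t) < 3 * h"
    using dist_triangle2[of p "bvp_pos a b z t" "a + t *\<^sub>R (b - a)"] by linarith
  then show "bvp_pos a b z t \<in> ball p R" using h by simp
qed

text \<open>With velocities bounded by \<open>4 * h\<close>, the Lipschitz constant is at most
  \<open>20 * (C * h) \<le> 1 / 4\<close>. The factor \<open>2 * d\<close> then leaves contraction
  constant 1/2 for fixed endpoints.\<close>

lemma rhs_dist_le:
  assumes "a \<in> ball p h" "b \<in> ball p h" "continuous_on {0..1} z" "\<And>s. s \<in> {0..1} \<Longrightarrow> norm (z s) \<le> h"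
    and "a' \<in> ball p h" "b' \<in> ball p h" "continuous_on {0..1} y" "\<And>s. s \<in> {0..1} \<Longrightarrow> norm (y s) \<le> h"
    and d: "\<And>s. s \<in> {0..1} \<Longrightarrow> norm (z s - y s) \<le> d" and t: "t \<in> {0..1}"
  shows "norm (f (bvp_pos a b z t) (bvp_vel a b z t) - f (bvp_pos a' b' y t) (bvp_vel a' b' y t))
    \<le> (norm (a - a') + norm (b - b') + 2 * d) / 4"
proof -
  let ?D = "norm (a - a') + norm (b - b') + 2 * d"
  have "0 \<le> d" using d[of 0] norm_ge_zero[of "z 0 - y 0"] by (simp del: norm_ge_zero)
  then have D: "0 \<le> ?D" by simp
  note B = bounds[OF assms(1-4) t] and B' = bounds[OF assms(5-8) t]
  note L = bvp_dist_le[OF assms(3,7) d t, of a b a' b']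
  have "norm (f (bvp_pos a b z t) (bvp_vel a b z t) - f (bvp_pos a' b' y t) (bvp_vel a' b' y t))
    \<le> C * ((4 * h)\<^sup>2 * norm (bvp_pos a b z t - bvp_pos a' b' y t)
        + 4 * h * norm (bvp_vel a b z t - bvp_vel a' b' y t))"
    by (rule lip) (use B B' in auto)
  also have "\<dots> \<le> C * ((4 * h)\<^sup>2 * ?D + 4 * h * ?D)"
    using L h(1) C by (intro mult_left_mono add_mono) auto
  also have "\<dots> \<le> C * (16 * h * ?D + 4 * h * ?D)"
    using h(1,2) C D by (intro mult_left_mono add_mono mult_right_mono) (auto simp: power2_eq_square)
  also have "\<dots> = 20 * (C * h) * ?D" by (simp add: algebra_simps)
  also have "\<dots> \<le> 1 / 4 * ?D" using D h(4) by (intro mult_right_mono) auto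
  finally show ?thesis by simp
qed

text \<open>Continuity comes from the Lipschitz estimate with \<open>r = 4 * h\<close>, applied to
  the continuous position and velocity and squeezed to zero.\<close>

lemma rhs_continuous:
  assumes "a \<in> ball p h" "b \<in> ball p h" "continuous_on {0..1} z" "\<And>s. s \<in> {0..1} \<Longrightarrow> norm (z s) \<le> h"
  shows "continuous_on {0..1} (\<lambda>t. f (bvp_pos a b z t) (bvp_vel a b z t))"
proof -
  let ?x = "bvp_pos a b z" and ?v = "bvp_vel a b z"
  have cx: "continuous_on {0..1} ?x" "continuous_on {0..1} ?v"
    by (rule continuous_on_vector_derivative, rule bvp_has_vector_derivative[OF assms(3)], assumption)+
  note B = bounds[OF assms]
  show ?thesis
    unfolding continuous_on_def
  proof
    fix t :: real assume t: "t \<in> {0..1}"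
    have "((\<lambda>s. C * ((4 * h)\<^sup>2 * norm (?x s - ?x t) + 4 * h * norm (?v s - ?v t)))
        \<longlongrightarrow> C * ((4 * h)\<^sup>2 * norm (?x t - ?x t) + 4 * h * norm (?v t - ?v t))) (at t within {0..1})"
      using cx t by (intro tendsto_intros) (auto simp: continuous_on_def)
    then have "((\<lambda>s. C * ((4 * h)\<^sup>2 * norm (?x s - ?x t) + 4 * h * norm (?v s - ?v t))) \<longlongrightarrow> 0) (at t within {0..1})"
      by simp
    then have "((\<lambda>s. f (?x s) (?v s) - f (?x t) (?v t)) \<longlongrightarrow> 0) (at t within {0..1})"
    proof (rule Lim_null_comparison[rotated])
      show "\<forall>\<^sub>F s in at t within {0..1}. norm (f (?x s) (?v s) - f (?x t) (?v t))
        \<le> C * ((4 * h)\<^sup>2 * norm (?x s - ?x t) + 4 * h * norm (?v s - ?v t))"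
        unfolding eventually_at_filter by (intro always_eventually allI impI lip B t)
    qed
    then show "((\<lambda>s. f (?x s) (?v s)) \<longlongrightarrow> f (?x t) (?v t)) (at t within {0..1})"
      by (rule LIM_zero_cancel)
  qed
qed

text \<open>Banach's fixed point theorem for the acceleration, in the closed ball of radius
  \<open>h\<close> of bounded continuous functions.\<close>

lemma solution_exists:
  assumes a: "a \<in> ball p h" and b: "b \<in> ball p h"
  shows "\<exists>z. continuous_on {0..1} z \<and>
    (\<forall>t\<in>{0..1}. norm (z t) \<le> h \<and> z t = f (bvp_pos a b z t) (bvp_vel a b z t))"
proof -
  \<comment> \<open>Elements of the function space live on the whole line, so the right-hand side on
    \<open>{0..1}\<close> is extended by its endpoint values through \<open>clamp\<close>.\<close>
  have "\<exists>y. \<forall>t. apply_bcontfun y t = f (bvp_pos a b z (clamp 0 1 t)) (bvp_vel a b z (clamp 0 1 t))"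
    if z: "z \<in> cball 0 h" for z :: "real \<Rightarrow>\<^sub>C 'a"
  proof -
    have "norm (z s) \<le> h" for s using norm_bounded[of z s] z by simp
    from rhs_continuous[OF a b _ this]
    have "continuous_on (cbox 0 1) (\<lambda>t. f (bvp_pos a b z t) (bvp_vel a b z t))" by simp
    from continuous_on_cbox_bcontfunE[OF this] show ?thesis by metis
  qed
  then obtain T :: "(real \<Rightarrow>\<^sub>C 'a) \<Rightarrow> (real \<Rightarrow>\<^sub>C 'a)" where T: "\<And>z t. z \<in> cball 0 h \<Longrightarrow>
      apply_bcontfun (T z) t = f (bvp_pos a b z (clamp 0 1 t)) (bvp_vel a b z (clamp 0 1 t))"
    by metis
  have cl: "clamp 0 1 t \<in> {0..1}" for t :: real using clamp_in_interval[of 0 1 t] by simp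
  have nz: "norm (z s) \<le> h" if "z \<in> cball 0 h" for z :: "real \<Rightarrow>\<^sub>C 'a" and s
    using norm_bounded[of z s] that by simp
  have "\<exists>!z. z \<in> cball (0 :: real \<Rightarrow>\<^sub>C 'a) h \<and> T z = z"
  proof (rule Banach_fix[where c = "1/2"])
    show "complete (cball (0 :: real \<Rightarrow>\<^sub>C 'a) h)" by (simp add: complete_eq_closed)
    show "cball (0 :: real \<Rightarrow>\<^sub>C 'a) h \<noteq> {}" using h by simp
    show "T ` cball 0 h \<subseteq> cball 0 h"
    proof
      fix y assume "y \<in> T ` cball 0 h"
      then obtain z where z: "z \<in> cball 0 h" "y = T z" by auto
      have "norm (y t) \<le> h" for t
      proof -
        \<comment> \<open>Speeds are at most \<open>4 * h\<close>, so quadratic growth gives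
          \<open>16 * (C * h) * h\<close>, below \<open>h\<close> by the choice of \<open>h\<close>:
          the map preserves the ball.\<close>
        have "norm (y t) \<le> C * (4 * h)\<^sup>2"
          unfolding z(2) T[OF z(1)] by (intro growth bounds a b nz z cl) auto
        also have "\<dots> = 16 * (C * h) * h" by (simp add: power2_eq_square)
        also have "\<dots> \<le> 1 * h" using h by (intro mult_right_mono) auto
        finally show ?thesis by simp
      qed
      then show "y \<in> cball 0 h" by (simp add: norm_bound)
    qed
    show "dist (T z) (T y) \<le> 1/2 * dist z y" if "z \<in> cball 0 h" "y \<in> cball 0 h" for z y
    proof (rule dist_bound)
      fix t
      have "norm (z s - y s) \<le> dist z y" for s using dist_bounded[of z s y] by (simp add: dist_norm)
      then have "norm (f (bvp_pos a b z (clamp 0 1 t)) (bvp_vel a b z (clamp 0 1 t))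
          - f (bvp_pos a b y (clamp 0 1 t)) (bvp_vel a b y (clamp 0 1 t))) \<le> (norm (a - a) + norm (b - b) + 2 * dist z y) / 4"
        using that by (intro rhs_dist_le a b nz cl) auto
      with that
      show "dist (T z t) (T y t) \<le> 1/2 * dist z y" by (simp add: T dist_norm)
    qed
  qed auto
  then obtain z where z: "z \<in> cball 0 h" "T z = z" by blast
  have "z t = f (bvp_pos a b z t) (bvp_vel a b z t)" if "t \<in> {0..1}" for t
    using T[OF z(1), of t] that z(2) by (simp add: clamp_cancel_cbox)
  with nz[OF z(1)] show ?thesis
    by (intro exI[of _ "apply_bcontfun z"] conjI ballI continuous_on_apply_bcontfun)
qed

definition acc :: "'a \<Rightarrow> 'a \<Rightarrow> real \<Rightarrow> 'a" where
  "acc a b = (SOME z. continuous_on {0..1} z \<and>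
    (\<forall>t\<in>{0..1}. norm (z t) \<le> h \<and> z t = f (bvp_pos a b z t) (bvp_vel a b z t)))"

definition "pos a b = bvp_pos a b (acc a b)"
definition "vel a b = bvp_vel a b (acc a b)"

lemma acc:
  assumes "a \<in> ball p h" "b \<in> ball p h"
  shows "continuous_on {0..1} (acc a b)"
    and "t \<in> {0..1} \<Longrightarrow> norm (acc a b t) \<le> h"
    and "t \<in> {0..1} \<Longrightarrow> acc a b t = f (pos a b t) (vel a b t)"
  unfolding pos_def vel_def
  using someI_ex[OF solution_exists[OF assms], folded acc_def] by blast+

lemma sup_attained:
  fixes z :: "real \<Rightarrow> 'a"
  assumes "continuous_on {0..1} z"
  obtains m where "m \<in> {0..1}" "\<And>s. s \<in> {0..1} \<Longrightarrow> norm (z s) \<le> norm (z m)"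
proof -
  have "continuous_on {0..1} (\<lambda>s. norm (z s))" using assms by (rule continuous_on_norm)
  then show ?thesis using continuous_attains_sup[of "{0..1::real}" "\<lambda>s. norm (z s)"] that by fastforce
qed

text \<open>A bootstrap. At the point \<open>m\<close> of largest acceleration the speed is at most
  \<open>M\<close>, the chord length plus twice that acceleration. Growth bounds the acceleration by
  \<open>C * M\<^sup>2\<close>, hence by \<open>M / 20\<close>, which is absorbed to give
  \<open>M \<le> 2 * norm (b - a)\<close>. Inserted once more, this makes the acceleration quadratic
  in the chord.\<close>

lemma vel_approx:
  assumes ab: "a \<in> ball p h" "b \<in> ball p h" and t: "t \<in> {0..1}"
  shows "norm (vel a b t - (b - a)) \<le> 8 * C * (norm (b - a))\<^sup>2"
proof -
  obtain m where m: "m \<in> {0..1}" "\<And>s. s \<in> {0..1} \<Longrightarrow> norm (acc a b s) \<le> norm (acc a b m)"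
    using sup_attained[OF acc(1)[OF ab]] by blast
  let ?n = "norm (acc a b m)"
  have v: "norm (vel a b s - (b - a)) \<le> 2 * ?n" if "s \<in> {0..1}" for s
    unfolding vel_def by (intro bvp_norm_le acc ab m that)
  define M where "M = norm (b - a) + 2 * ?n"
  have vM: "norm (vel a b m) \<le> M"
    using v[OF m(1)] norm_triangle_ineq2[of "vel a b m" "b - a"] by (simp add: M_def)
  have pR: "pos a b m \<in> ball p R" unfolding pos_def by (intro bounds acc ab m)
  have nM: "?n \<le> C * M\<^sup>2"
    using growth[OF pR vM] acc(3)[OF ab m(1)] by simp
  have ba: "norm (b - a) \<le> 2 * h"
    using ab dist_triangle[of b a p] by (auto simp: dist_norm norm_minus_commute)
  have M: "0 \<le> M" "M \<le> 4 * h" using acc(2)[OF ab m(1)] ba by (auto simp: M_def)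
  have "C * M\<^sup>2 = (C * M) * M" by (simp add: power2_eq_square)
  also have "\<dots> \<le> (C * (4 * h)) * M" using M C by (intro mult_right_mono mult_left_mono) auto
  also have "\<dots> \<le> 1/20 * M" using M h by (intro mult_right_mono) auto
  finally have "C * M\<^sup>2 \<le> M / 20" by simp
  then have "?n \<le> M / 20" using nM by linarith
  then have "9 * M \<le> 10 * norm (b - a)" unfolding M_def by (simp add: field_simps)
  then have "M \<le> 2 * norm (b - a)" using M(1) by linarith
  then have "C * M\<^sup>2 \<le> C * (2 * norm (b - a))\<^sup>2" using M C by (intro mult_left_mono power_mono) auto
  then show ?thesis using nM v[OF t] by (simp add: power_mult_distrib)
qed

text \<open>Taken where the accelerations differ most, the estimate \<open>rhs_dist_le\<close>
  bounds this difference by half of itself plus endpoint terms, and the half is absorbed.\<close>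

lemma dependence:
  assumes ab: "a \<in> ball p h" "b \<in> ball p h" and ab': "a' \<in> ball p h" "b' \<in> ball p h"
    and t: "t \<in> {0..1}"
  shows "norm (pos a b t - pos a' b' t) \<le> 2 * (norm (a - a') + norm (b - b'))"
    and "norm (vel a b t - vel a' b' t) \<le> 2 * (norm (a - a') + norm (b - b'))"
proof -
  obtain m where m: "m \<in> {0..1}"
    "\<And>s. s \<in> {0..1} \<Longrightarrow> norm (acc a b s - acc a' b' s) \<le> norm (acc a b m - acc a' b' m)"
    using sup_attained[OF continuous_on_diff[OF acc(1)[OF ab] acc(1)[OF ab']]] by blast
  let ?d = "norm (acc a b m - acc a' b' m)"
  note A = acc(1,2)[OF ab] and A' = acc(1,2)[OF ab']
  have "?d \<le> (norm (a - a') + norm (b - b') + 2 * ?d) / 4"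
    using rhs_dist_le[OF ab A ab' A' m(2,1)]
    unfolding pos_def[symmetric] vel_def[symmetric] acc(3)[OF ab m(1), symmetric] acc(3)[OF ab' m(1), symmetric] .
  then have d: "2 * ?d \<le> norm (a - a') + norm (b - b')" by simp
  show "norm (pos a b t - pos a' b' t) \<le> 2 * (norm (a - a') + norm (b - b'))"
    and "norm (vel a b t - vel a' b' t) \<le> 2 * (norm (a - a') + norm (b - b'))"
    using bvp_dist_le[OF A(1) A'(1) m(2) t, where a=a and b=b and a'=a' and b'=b'] d
    unfolding pos_def vel_def by simp_all
qed

lemma solution:
  assumes "a \<in> ball p h" "b \<in> ball p h"
  shows "pos a b 0 = a" "pos a b 1 = b"
    and "t \<in> {0..1} \<Longrightarrow> (pos a b has_vector_derivative vel a b t) (at t within {0..1})"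
    and "t \<in> {0..1} \<Longrightarrow> (vel a b has_vector_derivative acc a b t) (at t within {0..1})"
    and "t \<in> {0..1} \<Longrightarrow> pos a b t \<in> ball p R"
  using bvp_endpoints bvp_has_vector_derivative[OF acc(1)[OF assms]] bounds(1)[OF assms acc(1,2)[OF assms]]
  by (auto simp: pos_def vel_def)

end

subsection \<open>Bounded Lipschitz coefficients\<close>

text \<open>Boundedness is part of the notion because products of Lipschitz functions are Lipschitz
  only when the factors are bounded.\<close>

definition bdd_lipschitz :: "'a::metric_space set \<Rightarrow> ('a \<Rightarrow> real) \<Rightarrow> bool" where
  "bdd_lipschitz K f \<longleftrightarrow> (\<exists>C\<ge>0. \<forall>x\<in>K. \<forall>y\<in>K. \<bar>f x\<bar> \<le> C \<and> \<bar>f x - f y\<bar> \<le> C * dist x y)"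

lemma bdd_lipschitz_const [intro]: "bdd_lipschitz K (\<lambda>_. c)"
  unfolding bdd_lipschitz_def by (intro exI[of _ "\<bar>c\<bar>"]) auto

lemma bdd_lipschitz_add [intro]:
  assumes "bdd_lipschitz K f" "bdd_lipschitz K g" shows "bdd_lipschitz K (\<lambda>x. f x + g x)"
proof -
  obtain C D where C: "C \<ge> 0" "\<And>x y. x \<in> K \<Longrightarrow> y \<in> K \<Longrightarrow> \<bar>f x\<bar> \<le> C \<and> \<bar>f x - f y\<bar> \<le> C * dist x y"
    and D: "D \<ge> 0" "\<And>x y. x \<in> K \<Longrightarrow> y \<in> K \<Longrightarrow> \<bar>g x\<bar> \<le> D \<and> \<bar>g x - g y\<bar> \<le> D * dist x y"
    using assms unfolding bdd_lipschitz_def by metis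
  show ?thesis
    unfolding bdd_lipschitz_def
  proof (intro exI[of _ "C + D"] conjI ballI)
    fix x y assume "x \<in> K" "y \<in> K"
    with C(2) D(2) have "\<bar>f x\<bar> \<le> C" "\<bar>g x\<bar> \<le> D"
      "\<bar>f x - f y\<bar> \<le> C * dist x y" "\<bar>g x - g y\<bar> \<le> D * dist x y" by auto
    then show "\<bar>f x + g x\<bar> \<le> C + D" "\<bar>f x + g x - (f y + g y)\<bar> \<le> (C + D) * dist x y"
      by (auto simp: distrib_right)
  qed (use C D in auto)
qed

lemma bdd_lipschitz_mult [intro]:
  assumes "bdd_lipschitz K f" "bdd_lipschitz K g" shows "bdd_lipschitz K (\<lambda>x. f x * g x)"
proof -
  obtain C D where C: "C \<ge> 0" "\<And>x y. x \<in> K \<Longrightarrow> y \<in> K \<Longrightarrow> \<bar>f x\<bar> \<le> C \<and> \<bar>f x - f y\<bar> \<le> C * dist x y"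
    and D: "D \<ge> 0" "\<And>x y. x \<in> K \<Longrightarrow> y \<in> K \<Longrightarrow> \<bar>g x\<bar> \<le> D \<and> \<bar>g x - g y\<bar> \<le> D * dist x y"
    using assms unfolding bdd_lipschitz_def by metis
  show ?thesis
    unfolding bdd_lipschitz_def
  proof (intro exI[of _ "2 * C * D"] conjI ballI)
    fix x y assume xy: "x \<in> K" "y \<in> K"
    with C(2) D(2) have *: "\<bar>f x\<bar> \<le> C" "\<bar>g x\<bar> \<le> D" "\<bar>f y\<bar> \<le> C" "\<bar>g y\<bar> \<le> D"
      "\<bar>f x - f y\<bar> \<le> C * dist x y" "\<bar>g x - g y\<bar> \<le> D * dist x y" by blast+
    have "\<bar>f x * g x\<bar> \<le> C * D" unfolding abs_mult by (intro mult_mono * C) auto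
    also have "\<dots> \<le> 2 * C * D" using C D by simp
    finally show "\<bar>f x * g x\<bar> \<le> 2 * C * D" .
    have "f x * g x - f y * g y = (f x - f y) * g x + f y * (g x - g y)" by (simp add: algebra_simps)
    also have "\<bar>\<dots>\<bar> \<le> \<bar>f x - f y\<bar> * \<bar>g x\<bar> + \<bar>f y\<bar> * \<bar>g x - g y\<bar>"
      by (metis abs_mult abs_triangle_ineq)
    also have "\<dots> \<le> (C * dist x y) * D + C * (D * dist x y)"
      using C D by (intro add_mono mult_mono *) auto
    finally show "\<bar>f x * g x - f y * g y\<bar> \<le> 2 * C * D * dist x y" by (simp add: algebra_simps)
  qed (use C D in auto)
qed

lemma bdd_lipschitz_uminus [intro]: "bdd_lipschitz K f \<Longrightarrow> bdd_lipschitz K (\<lambda>x. - f x)"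
  using bdd_lipschitz_mult[OF bdd_lipschitz_const[of K "- 1"]] by simp

lemma bdd_lipschitz_diff [intro]: "bdd_lipschitz K f \<Longrightarrow> bdd_lipschitz K g \<Longrightarrow> bdd_lipschitz K (\<lambda>x. f x - g x)"
  using bdd_lipschitz_add[OF _ bdd_lipschitz_uminus] by simp

lemma bdd_lipschitz_inverse:
  assumes "bdd_lipschitz K f" "c > 0" "\<And>x. x \<in> K \<Longrightarrow> c \<le> f x"
  shows "bdd_lipschitz K (\<lambda>x. 1 / f x)"
proof -
  obtain C where C: "C \<ge> 0" "\<And>x y. x \<in> K \<Longrightarrow> y \<in> K \<Longrightarrow> \<bar>f x\<bar> \<le> C \<and> \<bar>f x - f y\<bar> \<le> C * dist x y"
    using assms unfolding bdd_lipschitz_def by metis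
  show ?thesis
    unfolding bdd_lipschitz_def
  proof (intro exI[of _ "1 / c + C / c\<^sup>2"] conjI ballI)
    fix x y assume xy: "x \<in> K" "y \<in> K"
    have p: "c \<le> f x" "c \<le> f y" using assms xy by auto
    have "\<bar>1 / f x\<bar> \<le> 1 / c" using p \<open>c > 0\<close> by (auto simp: field_simps)
    also have "\<dots> \<le> 1 / c + C / c\<^sup>2" using C by simp
    finally show "\<bar>1 / f x\<bar> \<le> 1 / c + C / c\<^sup>2" .
    have "1 / f x - 1 / f y = (f y - f x) / (f x * f y)" using p \<open>c > 0\<close> by (auto simp: field_simps)
    also have "\<bar>\<dots>\<bar> = \<bar>f x - f y\<bar> / (f x * f y)"
      using p \<open>c > 0\<close> by (simp add: abs_minus_commute)
    also have "\<dots> \<le> (C * dist x y) / c\<^sup>2"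
      using p \<open>c > 0\<close> C xy by (intro frac_le) (auto simp: power2_eq_square intro: mult_mono)
    also have "\<dots> \<le> (1 / c + C / c\<^sup>2) * dist x y" using \<open>c > 0\<close> by (simp add: distrib_right)
    finally show "\<bar>1 / f x - 1 / f y\<bar> \<le> (1 / c + C / c\<^sup>2) * dist x y" .
  qed (use C \<open>c > 0\<close> in auto)
qed

text \<open>The hypotheses \<open>growth\<close> and \<open>lip\<close> of
  \<open>quadratic_ode\<close> as a property of the right-hand side, so that it can be built up from
  monomials.\<close>

definition quadratic_bound :: "'a::real_normed_vector set \<Rightarrow> ('a \<Rightarrow> 'b::real_normed_vector \<Rightarrow> 'c::real_normed_vector) \<Rightarrow> bool"
  where "quadratic_bound K q \<longleftrightarrow> (\<exists>C>0. \<forall>x\<in>K. \<forall>y\<in>K. \<forall>v w r. norm v \<le> r \<longrightarrow> norm w \<le> r \<longrightarrow>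
    norm (q x v) \<le> C * r\<^sup>2 \<and> norm (q x v - q y w) \<le> C * (r\<^sup>2 * norm (x - y) + r * norm (v - w)))"

lemma quadratic_boundE:
  assumes "quadratic_bound K q"
  obtains C where "C > 0" "\<And>x v r. x \<in> K \<Longrightarrow> norm v \<le> r \<Longrightarrow> norm (q x v) \<le> C * r\<^sup>2"
    "\<And>x y v w r. x \<in> K \<Longrightarrow> y \<in> K \<Longrightarrow> norm v \<le> r \<Longrightarrow> norm w \<le> r \<Longrightarrow>
        norm (q x v - q y w) \<le> C * (r\<^sup>2 * norm (x - y) + r * norm (v - w))"
  using assms unfolding quadratic_bound_def by metis

text \<open>Common source of the rules for sums and for pairs: in both cases the norm is at most the
  sum of the norms of the two parts.\<close>

lemma quadratic_bound_combine:
  fixes F :: "'a::real_normed_vector \<Rightarrow> 'b::real_normed_vector \<Rightarrow> 'c::real_normed_vector"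
  assumes "quadratic_bound K q" "quadratic_bound K s"
    and F: "\<And>x v. norm (F x v) \<le> norm (q x v) + norm (s x v)"
    and F2: "\<And>x y v w. norm (F x v - F y w) \<le> norm (q x v - q y w) + norm (s x v - s y w)"
  shows "quadratic_bound K F"
proof -
  obtain C where C: "C > 0" "\<And>x v r. x \<in> K \<Longrightarrow> norm v \<le> r \<Longrightarrow> norm (q x v) \<le> C * r\<^sup>2"
    "\<And>x y v w r. x \<in> K \<Longrightarrow> y \<in> K \<Longrightarrow> norm v \<le> r \<Longrightarrow> norm w \<le> r \<Longrightarrow>
        norm (q x v - q y w) \<le> C * (r\<^sup>2 * norm (x - y) + r * norm (v - w))"
    using quadratic_boundE[OF assms(1)] by metis
  obtain D where D: "D > 0" "\<And>x v r. x \<in> K \<Longrightarrow> norm v \<le> r \<Longrightarrow> norm (s x v) \<le> D * r\<^sup>2"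
    "\<And>x y v w r. x \<in> K \<Longrightarrow> y \<in> K \<Longrightarrow> norm v \<le> r \<Longrightarrow> norm w \<le> r \<Longrightarrow>
        norm (s x v - s y w) \<le> D * (r\<^sup>2 * norm (x - y) + r * norm (v - w))"
    using quadratic_boundE[OF assms(2)] by metis
  show ?thesis
    unfolding quadratic_bound_def
  proof (intro exI[of _ "C + D"] conjI ballI allI impI)
    fix x y :: 'a and v w :: 'b and r :: real assume *: "x \<in> K" "y \<in> K" "norm v \<le> r" "norm w \<le> r"
    show "norm (F x v) \<le> (C + D) * r\<^sup>2"
      using F[of x v] C(2)[OF *(1,3)] D(2)[OF *(1,3)] by (simp add: distrib_right)
    show "norm (F x v - F y w) \<le> (C + D) * (r\<^sup>2 * norm (x - y) + r * norm (v - w))"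
      using F2[of x v y w] C(3)[OF *] D(3)[OF *] unfolding distrib_right[of C D] by linarith
  qed (use C D in auto)
qed

lemma quadratic_bound_add [intro]:
  assumes "quadratic_bound K q" "quadratic_bound K s" shows "quadratic_bound K (\<lambda>x v. q x v + s x v)"
  by (rule quadratic_bound_combine[OF assms]) (auto simp: norm_triangle_ineq add_diff_add)

lemma quadratic_bound_Pair [intro]:
  assumes "quadratic_bound K q" "quadratic_bound K s" shows "quadratic_bound K (\<lambda>x v. (q x v, s x v))"
  by (rule quadratic_bound_combine[OF assms]) (auto simp: norm_Pair_le)

text \<open>Here \<open>l\<close> and \<open>m\<close> stand for the coordinate projections. The
  difference of two values is split by changing first the coefficient and then the
  velocities.\<close>

lemma quadratic_bound_monomial:
  fixes c :: "'a::real_normed_vector \<Rightarrow> real" and l m :: "'b::real_normed_vector \<Rightarrow> real"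
  assumes "bdd_lipschitz K c" and l: "\<And>v. \<bar>l v\<bar> \<le> norm v" "\<And>v w. l (v - w) = l v - l w"
    and m: "\<And>v. \<bar>m v\<bar> \<le> norm v" "\<And>v w. m (v - w) = m v - m w"
  shows "quadratic_bound K (\<lambda>x v. c x * (l v * m v))"
proof -
  obtain C where C: "C \<ge> 0" "\<And>x y. x \<in> K \<Longrightarrow> y \<in> K \<Longrightarrow> \<bar>c x\<bar> \<le> C \<and> \<bar>c x - c y\<bar> \<le> C * dist x y"
    using assms unfolding bdd_lipschitz_def by metis
  show ?thesis
    unfolding quadratic_bound_def
  \<comment> \<open>The two velocity factors account for \<open>2 * C\<close>; the 1 makes the
    constant strictly positive.\<close>
  proof (intro exI[of _ "2 * C + 1"] conjI ballI allI impI)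
    fix x y :: 'a and v w :: 'b and r :: real assume *: "x \<in> K" "y \<in> K" "norm v \<le> r" "norm w \<le> r"
    have r: "0 \<le> r" using *(3) norm_ge_zero order_trans by blast
    have c: "\<bar>c x\<bar> \<le> C" "\<bar>c y\<bar> \<le> C" "\<bar>c x - c y\<bar> \<le> C * norm (x - y)"
      using C(2) * by (auto simp: dist_norm)
    have lm: "\<bar>l v\<bar> \<le> r" "\<bar>m v\<bar> \<le> r" "\<bar>l w\<bar> \<le> r" "\<bar>m w\<bar> \<le> r"
      using l(1) m(1) *(3,4) order_trans by blast+
    have d: "\<bar>l v - l w\<bar> \<le> norm (v - w)" "\<bar>m v - m w\<bar> \<le> norm (v - w)"
      using l(1)[of "v - w"] m(1)[of "v - w"] l(2) m(2) by auto
    have vv: "\<bar>l v * m v\<bar> \<le> r * r" unfolding abs_mult by (intro mult_mono lm r) auto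
    have "\<bar>c x * (l v * m v)\<bar> \<le> C * (r * r)"
      unfolding abs_mult[of "c x"] by (intro mult_mono c vv C) auto
    also have "\<dots> \<le> (2 * C + 1) * r\<^sup>2" using C r by (simp add: power2_eq_square distrib_right)
    finally show "norm (c x * (l v * m v)) \<le> (2 * C + 1) * r\<^sup>2" by simp
    have "l v * m v - l w * m w = (l v - l w) * m v + l w * (m v - m w)" by (simp add: algebra_simps)
    also have "\<bar>\<dots>\<bar> \<le> \<bar>l v - l w\<bar> * \<bar>m v\<bar> + \<bar>l w\<bar> * \<bar>m v - m w\<bar>" by (metis abs_mult abs_triangle_ineq)
    also have "\<dots> \<le> norm (v - w) * r + r * norm (v - w)" by (intro add_mono mult_mono lm d r) auto
    finally have vw: "\<bar>l v * m v - l w * m w\<bar> \<le> 2 * r * norm (v - w)" by simp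
    have "c x * (l v * m v) - c y * (l w * m w) = (c x - c y) * (l v * m v) + c y * (l v * m v - l w * m w)"
      by (simp add: algebra_simps)
    also have "\<bar>\<dots>\<bar> \<le> \<bar>c x - c y\<bar> * \<bar>l v * m v\<bar> + \<bar>c y\<bar> * \<bar>l v * m v - l w * m w\<bar>"
      by (metis abs_mult abs_triangle_ineq)
    also have "\<dots> \<le> (C * norm (x - y)) * (r * r) + C * (2 * r * norm (v - w))"
      using C by (intro add_mono mult_mono c vv vw) auto
    also have "\<dots> \<le> (2 * C + 1) * (r\<^sup>2 * norm (x - y) + r * norm (v - w))"
      using C r by (simp add: power2_eq_square algebra_simps)
    finally show "norm (c x * (l v * m v) - c y * (l w * m w))
      \<le> (2 * C + 1) * (r\<^sup>2 * norm (x - y) + r * norm (v - w))" by simp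
  qed (use C in auto)
qed

lemma abs_fst_le_norm: "\<bar>fst v\<bar> \<le> norm v" and abs_snd_le_norm: "\<bar>snd v\<bar> \<le> norm v"
  for v :: "real \<times> real"
  using norm_fst_le[of "fst v" "snd v"] norm_snd_le[of "snd v" "fst v"] by simp_all

lemma quadratic_bound_form:
  fixes \<alpha> \<beta> \<gamma> :: "'a::real_normed_vector \<Rightarrow> real"
  assumes "bdd_lipschitz K \<alpha>" "bdd_lipschitz K \<beta>" "bdd_lipschitz K \<gamma>"
  shows "quadratic_bound K (\<lambda>x (v::pt). \<alpha> x * (fst v * fst v) + \<beta> x * (fst v * snd v) + \<gamma> x * (snd v * snd v))"
  by (intro quadratic_bound_add quadratic_bound_monomial assms abs_fst_le_norm abs_snd_le_norm) auto

section \<open>Calculus of smooth functions: partial derivatives, chain rule, Lipschitz and Taylor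
  bounds\<close>

lemma smooth_fun_onD:
  assumes "smooth_fun_on S f"
  shows "f differentiable_on S" "smooth_fun_on S (pdiff 0 f)" "smooth_fun_on S (pdiff (Suc 0) f)" "continuous_on S f"
proof -
  have "Ck_on (Suc k) S f" for k using assms unfolding smooth_fun_on_def by blast
  then show "f differentiable_on S" "smooth_fun_on S (pdiff 0 f)" "smooth_fun_on S (pdiff (Suc 0) f)"
    unfolding smooth_fun_on_def by auto
  show "continuous_on S f" using assms unfolding smooth_fun_on_def by (metis Ck_on.simps(1))
qed

lemma has_derivative_pdiff:
  assumes "open S" "f differentiable_on S" "q \<in> S"
  shows "(f has_derivative (\<lambda>d. fst d * pdiff 0 f q + snd d * pdiff (Suc 0) f q)) (at q)"
proof -
  have "f differentiable (at q)"
    using assms differentiable_on_eq_differentiable_at by blast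
  then have D: "(f has_derivative frechet_derivative f (at q)) (at q)"
    unfolding frechet_derivative_works .
  then have lin: "linear (frechet_derivative f (at q))" by (rule has_derivative_linear)
  have "frechet_derivative f (at q) d = fst d * pdiff 0 f q + snd d * pdiff (Suc 0) f q" for d
  proof -
    have "d = fst d *\<^sub>R (1, 0) + snd d *\<^sub>R (0, 1)" by (simp add: prod_eq_iff)
    then have "frechet_derivative f (at q) d = frechet_derivative f (at q) (fst d *\<^sub>R (1, 0) + snd d *\<^sub>R (0, 1))"
      by (rule arg_cong)
    also have "\<dots> = fst d * frechet_derivative f (at q) (1, 0) + snd d * frechet_derivative f (at q) (0, 1)"
      using lin by (simp only: linear_add linear_cmul real_scaleR_def)
    finally show ?thesis by (simp add: pdiff_def)
  qed
  then have "frechet_derivative f (at q) = (\<lambda>d. fst d * pdiff 0 f q + snd d * pdiff (Suc 0) f q)" by blast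
  with D show ?thesis by (simp only:)
qed

lemma pdiff_chain:
  assumes "open S" "f differentiable_on S" "\<gamma> t \<in> S" "(\<gamma> has_vector_derivative v) (at t within T)"
  shows "((\<lambda>s. f (\<gamma> s)) has_real_derivative fst v * pdiff 0 f (\<gamma> t) + snd v * pdiff (Suc 0) f (\<gamma> t)) (at t within T)"
  using has_derivative_compose[OF assms(4)[unfolded has_vector_derivative_def] has_derivative_pdiff[OF assms(1-3)]]
  by (rule has_derivative_imp_has_field_derivative) (simp add: algebra_simps)

lemma onorm_le_sum_abs:
  "onorm (\<lambda>d::pt. fst d * a + snd d * b) \<le> \<bar>a\<bar> + \<bar>b\<bar>"
proof (rule onorm_le)
  fix d :: pt
  have "norm (fst d * a + snd d * b) \<le> \<bar>fst d\<bar> * \<bar>a\<bar> + \<bar>snd d\<bar> * \<bar>b\<bar>"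
    by (simp flip: abs_mult)
  also have "\<dots> \<le> norm d * \<bar>a\<bar> + norm d * \<bar>b\<bar>"
    by (intro add_mono mult_right_mono abs_fst_le_norm abs_snd_le_norm) auto
  finally show "norm (fst d * a + snd d * b) \<le> (\<bar>a\<bar> + \<bar>b\<bar>) * norm d" by (simp add: algebra_simps)
qed

text \<open>Compactness bounds the function and its partial derivatives; convexity gives the mean
  value inequality.\<close>

lemma bdd_lipschitz_smooth:
  assumes S: "open S" and f: "smooth_fun_on S f" and K: "compact K" "convex K" "K \<subseteq> S"
  shows "bdd_lipschitz K f"
proof -
  have "bounded (g ` K)" if "smooth_fun_on S g" for g
    using smooth_fun_onD(4)[OF that] K by (intro compact_imp_bounded compact_continuous_image) (auto intro: continuous_on_subset)
  then have "\<exists>B\<ge>0. \<forall>x\<in>K. \<bar>g x\<bar> \<le> B" if "smooth_fun_on S g" for g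
    using that unfolding bounded_pos by (metis image_eqI less_imp_le real_norm_def)
  note B = this
  obtain B0 B1 B2 where B: "B0 \<ge> 0" "B1 \<ge> 0" "B2 \<ge> 0" "\<And>x. x \<in> K \<Longrightarrow> \<bar>f x\<bar> \<le> B0"
    "\<And>x. x \<in> K \<Longrightarrow> \<bar>pdiff 0 f x\<bar> \<le> B1" "\<And>x. x \<in> K \<Longrightarrow> \<bar>pdiff (Suc 0) f x\<bar> \<le> B2"
    using B[OF f] B[OF smooth_fun_onD(2)[OF f]] B[OF smooth_fun_onD(3)[OF f]] by metis
  have lip: "norm (f x - f y) \<le> (B1 + B2) * norm (x - y)" if "x \<in> K" "y \<in> K" for x y
  proof (rule differentiable_bound[OF K(2) _ _ that])
    fix z assume z: "z \<in> K"
    show "(f has_derivative (\<lambda>d. fst d * pdiff 0 f z + snd d * pdiff (Suc 0) f z)) (at z within K)"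
      using has_derivative_pdiff[OF S smooth_fun_onD(1)[OF f]] z K by (blast intro: has_derivative_at_withinI)
    show "onorm (\<lambda>d. fst d * pdiff 0 f z + snd d * pdiff (Suc 0) f z) \<le> B1 + B2"
      using onorm_le_sum_abs B(5,6) z by (meson add_mono order_trans)
  qed
  show ?thesis
    unfolding bdd_lipschitz_def
  proof (intro exI[of _ "B0 + (B1 + B2)"] conjI ballI)
    fix x y assume xy: "x \<in> K" "y \<in> K"
    show "\<bar>f x\<bar> \<le> B0 + (B1 + B2)" using B(1-3) B(4)[OF xy(1)] by linarith
    show "\<bar>f x - f y\<bar> \<le> (B0 + (B1 + B2)) * dist x y"
      using lip[OF xy] B(1) by (simp add: dist_norm distrib_right add_increasing)
  qed (use B in auto)
qed

text \<open>The partial derivatives are themselves Lipschitz, so the derivative along the segment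
  from \<open>x\<close> to \<open>y\<close> differs from that at \<open>x\<close> by
  \<open>O(dist x y)\<close>; the mean value inequality gains one more factor.\<close>

lemma taylor_smooth:
  assumes S: "open S" and f: "smooth_fun_on S f" and K: "compact K" "convex K" "K \<subseteq> S"
  shows "\<exists>C\<ge>0. \<forall>x\<in>K. \<forall>y\<in>K. \<bar>f x\<bar> \<le> C \<and> \<bar>pdiff 0 f x\<bar> \<le> C \<and> \<bar>pdiff (Suc 0) f x\<bar> \<le> C \<and>
    \<bar>f y - f x - (fst (y - x) * pdiff 0 f x + snd (y - x) * pdiff (Suc 0) f x)\<bar> \<le> C * (norm (y - x))\<^sup>2"
proof -
  obtain A where A: "A \<ge> 0" "\<And>x. x \<in> K \<Longrightarrow> \<bar>f x\<bar> \<le> A"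
    using bdd_lipschitz_smooth[OF S f K] unfolding bdd_lipschitz_def by metis
  obtain B where B: "B \<ge> 0" "\<And>x y. x \<in> K \<Longrightarrow> y \<in> K \<Longrightarrow> \<bar>pdiff 0 f x\<bar> \<le> B \<and> \<bar>pdiff 0 f x - pdiff 0 f y\<bar> \<le> B * dist x y"
    using bdd_lipschitz_smooth[OF S smooth_fun_onD(2)[OF f] K] unfolding bdd_lipschitz_def by metis
  obtain C where C: "C \<ge> 0" "\<And>x y. x \<in> K \<Longrightarrow> y \<in> K \<Longrightarrow> \<bar>pdiff (Suc 0) f x\<bar> \<le> C \<and> \<bar>pdiff (Suc 0) f x - pdiff (Suc 0) f y\<bar> \<le> C * dist x y"
    using bdd_lipschitz_smooth[OF S smooth_fun_onD(3)[OF f] K] unfolding bdd_lipschitz_def by metis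
  show ?thesis
  proof (intro exI[of _ "A + (B + C)"] conjI ballI)
    fix x y assume xy: "x \<in> K" "y \<in> K"
    show "\<bar>f x\<bar> \<le> A + (B + C)" "\<bar>pdiff 0 f x\<bar> \<le> A + (B + C)" "\<bar>pdiff (Suc 0) f x\<bar> \<le> A + (B + C)"
      using A(1) B(1) C(1) A(2)[OF xy(1)] B(2)[OF xy] C(2)[OF xy] by linarith+
    \<comment> \<open>The intersection with the ball keeps the set convex and limits the points
      \<open>z\<close> to \<open>dist z x \<le> dist x y\<close>, where the variation of the
      derivative is controlled.\<close>
    define K' where "K' = K \<inter> cball x (dist x y)"
    let ?D = "\<lambda>z d. fst d * pdiff 0 f z + snd d * pdiff (Suc 0) f z"
    have "norm (f y - f x - ?D x (y - x)) \<le> norm (y - x) * ((B + C) * dist x y)"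
    proof (rule differentiable_bound_linearization[where S = K'])
      show "x \<in> K'" using xy by (simp add: K'_def)
      show "x + t *\<^sub>R (y - x) \<in> K'" if t: "t \<in> {0..1}" for t
      proof -
        have "convex K'" unfolding K'_def by (intro convex_Int K convex_cball)
        moreover have "x \<in> K'" "y \<in> K'" using xy by (auto simp: K'_def)
        ultimately have "(1 - t) *\<^sub>R x + t *\<^sub>R y \<in> K'" using t by (auto intro!: convexD_alt)
        then show ?thesis by (simp add: algebra_simps)
      qed
      fix z assume z: "z \<in> K'"
      then have zK: "z \<in> K" "dist z x \<le> dist x y" by (auto simp: K'_def dist_commute)
      show "(f has_derivative ?D z) (at z within K')"
        using has_derivative_pdiff[OF S smooth_fun_onD(1)[OF f]] zK K by (blast intro: has_derivative_at_withinI)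
      have "onorm (?D z - ?D x) = onorm (\<lambda>d::pt. fst d * (pdiff 0 f z - pdiff 0 f x) + snd d * (pdiff (Suc 0) f z - pdiff (Suc 0) f x))"
        by (rule arg_cong[where f = onorm]) (auto simp: algebra_simps)
      also have "\<dots> \<le> \<bar>pdiff 0 f z - pdiff 0 f x\<bar> + \<bar>pdiff (Suc 0) f z - pdiff (Suc 0) f x\<bar>"
        by (rule onorm_le_sum_abs)
      also have "\<dots> \<le> B * dist z x + C * dist z x"
        using B(2)[OF zK(1) xy(1)] C(2)[OF zK(1) xy(1)] by (intro add_mono) auto
      also have "\<dots> \<le> (B + C) * dist x y"
        using zK(2) B(1) C(1) by (simp add: mult_left_mono flip: distrib_right)
      finally show "onorm (?D z - ?D x) \<le> (B + C) * dist x y" .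
    qed
    also have "\<dots> = (B + C) * (norm (y - x))\<^sup>2"
      by (simp add: dist_norm norm_minus_commute power2_eq_square)
    also have "\<dots> \<le> (A + (B + C)) * (norm (y - x))\<^sup>2" using A(1) by (intro mult_right_mono) auto
    finally show "\<bar>f y - f x - ?D x (y - x)\<bar> \<le> (A + (B + C)) * (norm (y - x))\<^sup>2" by simp
  qed (use A B C in auto)
qed

subsection \<open>Geodesics and their energy\<close>

locale surface =
  fixes \<Omega> :: "pt set" and E F G :: "pt \<Rightarrow> real"
  assumes open_\<Omega>: "open \<Omega>"
    and smooth: "smooth_fun_on \<Omega> E" "smooth_fun_on \<Omega> F" "smooth_fun_on \<Omega> G"
    and posdef: "p \<in> \<Omega> \<Longrightarrow> E p > 0 \<and> E p * G p - (F p)\<^sup>2 > 0"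
begin

abbreviation "Eu \<equiv> pdiff 0 E"
abbreviation "Ev \<equiv> pdiff (Suc 0) E"
abbreviation "Fu \<equiv> pdiff 0 F"
abbreviation "Fv \<equiv> pdiff (Suc 0) F"
abbreviation "Gu \<equiv> pdiff 0 G"
abbreviation "Gv \<equiv> pdiff (Suc 0) G"

text \<open>The lowered geodesic equations written out. The coefficients are Christoffel symbols of
  the first kind, the mixed ones doubled by symmetry.\<close>

definition geo_eq :: "pt \<Rightarrow> pt \<Rightarrow> pt \<Rightarrow> bool" where
  "geo_eq x v a \<longleftrightarrow>
    E x * fst a + F x * snd a + (Eu x / 2 * (fst v)\<^sup>2 + Ev x * fst v * snd v + (Fv x - Gu x / 2) * (snd v)\<^sup>2) = 0 \<and>
    F x * fst a + G x * snd a + ((Fu x - Ev x / 2) * (fst v)\<^sup>2 + Gu x * fst v * snd v + Gv x / 2 * (snd v)\<^sup>2) = 0"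

lemma geodesic_equations_iff:
  "(\<forall>k<2. (\<Sum>l<2. gmat E F G k l x * comp l a)
     + (\<Sum>i<2. \<Sum>j<2. christ1 E F G k i j x * comp i v * comp j v) = 0) \<longleftrightarrow> geo_eq x v a"
proof -
  have "(\<forall>k<2. (\<Sum>l<2. gmat E F G k l x * comp l a)
     + (\<Sum>i<2. \<Sum>j<2. christ1 E F G k i j x * comp i v * comp j v) = 0) \<longleftrightarrow>
    E x * fst a + F x * snd a + (Eu x / 2 * fst v * fst v + Ev x / 2 * fst v * snd v
        + (Ev x / 2 * snd v * fst v + (Fv x + Fv x - Gu x) / 2 * snd v * snd v)) = 0 \<and>
    F x * fst a + G x * snd a + ((Fu x + Fu x - Ev x) / 2 * fst v * fst v + Gu x / 2 * fst v * snd v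
        + (Gu x / 2 * snd v * fst v + Gv x / 2 * snd v * snd v)) = 0"
    by (simp add: numeral_2_eq_2 All_less_Suc lessThan_Suc gmat_def comp_def christ1_def add_ac) (rule conj_commute)
  also have "\<dots> \<longleftrightarrow> geo_eq x v a"
    unfolding geo_eq_def by (simp add: power2_eq_square algebra_simps add_divide_distrib diff_divide_distrib)
  finally show ?thesis .
qed

text \<open>Squared speed. It is constant along a geodesic, and since the parameter runs through
  \<open>{0..1}\<close> this constant is the squared length.\<close>

definition energy :: "pt \<Rightarrow> pt \<Rightarrow> real" where
  "energy x v = E x * (fst v)\<^sup>2 + 2 * F x * fst v * snd v + G x * (snd v)\<^sup>2"

definition ip :: "pt \<Rightarrow> pt \<Rightarrow> pt \<Rightarrow> real" where
  "ip x v w = E x * fst v * fst w + F x * (fst v * snd w + snd v * fst w) + G x * snd v * snd w"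

lemma energy_nonneg:
  assumes "x \<in> \<Omega>" shows "energy x v \<ge> 0"
proof -
  have "E x * energy x v = (E x * fst v + F x * snd v)\<^sup>2 + (E x * G x - (F x)\<^sup>2) * (snd v)\<^sup>2"
    by (simp add: energy_def power2_eq_square algebra_simps)
  also have "\<dots> \<ge> 0" using posdef[OF assms] by simp
  finally show ?thesis using posdef[OF assms] by (simp add: zero_le_mult_iff)
qed

lemma diff_coeff: "E differentiable_on \<Omega>" "F differentiable_on \<Omega>" "G differentiable_on \<Omega>"
  using smooth smooth_fun_onD(1) by auto

lemma has_vector_derivative_fst_snd:
  assumes "(\<gamma> has_vector_derivative v) (at t within T)"
  shows "((\<lambda>s. fst (\<gamma> s)) has_real_derivative fst v) (at t within T)"
    and "((\<lambda>s. snd (\<gamma> s)) has_real_derivative snd v) (at t within T)"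
  using has_derivative_fst[OF assms[unfolded has_vector_derivative_def]]
    has_derivative_snd[OF assms[unfolded has_vector_derivative_def]]
  by (auto intro: has_derivative_imp_has_field_derivative)

definition geo_curve :: "(real \<Rightarrow> pt) \<Rightarrow> (real \<Rightarrow> pt) \<Rightarrow> (real \<Rightarrow> pt) \<Rightarrow> bool" where
  "geo_curve X V A \<longleftrightarrow> (\<forall>t\<in>{0..1}. X t \<in> \<Omega> \<and>
    (X has_vector_derivative V t) (at t within {0..1}) \<and>
    (V has_vector_derivative A t) (at t within {0..1}) \<and> geo_eq (X t) (V t) (A t))"

text \<open>The Euler-Lagrange equation: the right-hand side is the directional derivative of
  \<open>energy\<close> at \<open>(X t, V t)\<close> along \<open>(w t, w')\<close>. The product
  rule produces the lowered acceleration paired with \<open>w\<close>, and the geodesic equation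
  trades it for derivatives of the coefficients.\<close>

lemma ip_has_derivative:
  assumes "geo_curve X V A" and t: "t \<in> {0..1}"
    and w: "(w has_vector_derivative w') (at t within {0..1})"
  shows "((\<lambda>s. 2 * ip (X s) (V s) (w s)) has_real_derivative
    (fst (w t) * Eu (X t) + snd (w t) * Ev (X t)) * (fst (V t))\<^sup>2
    + 2 * (fst (w t) * Fu (X t) + snd (w t) * Fv (X t)) * fst (V t) * snd (V t)
    + (fst (w t) * Gu (X t) + snd (w t) * Gv (X t)) * (snd (V t))\<^sup>2
    + 2 * ip (X t) (V t) w') (at t within {0..1})"
proof -
  have g: "X t \<in> \<Omega>" "(X has_vector_derivative V t) (at t within {0..1})"
    "(V has_vector_derivative A t) (at t within {0..1})" "geo_eq (X t) (V t) (A t)"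
    using assms unfolding geo_curve_def by auto
  note D = pdiff_chain[OF open_\<Omega> diff_coeff(1) g(1,2)] pdiff_chain[OF open_\<Omega> diff_coeff(2) g(1,2)]
    pdiff_chain[OF open_\<Omega> diff_coeff(3) g(1,2)] has_vector_derivative_fst_snd[OF g(3)]
    has_vector_derivative_fst_snd[OF w]
  have *: "E (X t) * fst (A t) + F (X t) * snd (A t) = - (Eu (X t) / 2 * (fst (V t))\<^sup>2 + Ev (X t) * fst (V t) * snd (V t) + (Fv (X t) - Gu (X t) / 2) * (snd (V t))\<^sup>2)"
    "F (X t) * fst (A t) + G (X t) * snd (A t) = - ((Fu (X t) - Ev (X t) / 2) * (fst (V t))\<^sup>2 + Gu (X t) * fst (V t) * snd (V t) + Gv (X t) / 2 * (snd (V t))\<^sup>2)"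
    using g(4) unfolding geo_eq_def by linarith+
  let ?dE = "fst (V t) * Eu (X t) + snd (V t) * Ev (X t)"
  let ?dF = "fst (V t) * Fu (X t) + snd (V t) * Fv (X t)"
  let ?dG = "fst (V t) * Gu (X t) + snd (V t) * Gv (X t)"
  have d: "((\<lambda>s. 2 * ip (X s) (V s) (w s)) has_real_derivative
     2 * (?dE * fst (V t) * fst (w t) + ?dF * (fst (V t) * snd (w t) + snd (V t) * fst (w t)) + ?dG * snd (V t) * snd (w t)
      + fst (w t) * (E (X t) * fst (A t) + F (X t) * snd (A t)) + snd (w t) * (F (X t) * fst (A t) + G (X t) * snd (A t))
      + ip (X t) (V t) w')) (at t within {0..1})"
    unfolding ip_def
    by (rule derivative_eq_intros D refl)+ (simp add: algebra_simps)
  show ?thesis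
    by (rule DERIV_cong[OF d]) (unfold *, simp add: algebra_simps power2_eq_square)
qed

lemma energy_eq_ip: "energy x v = ip x v v"
  by (simp add: energy_def ip_def power2_eq_square algebra_simps)

lemma energy_constant:
  assumes X: "geo_curve X V A" and t: "t \<in> {0..1}" "s \<in> {0..1}"
  shows "energy (X t) (V t) = energy (X s) (V s)"
proof -
  have "((\<lambda>s. energy (X s) (V s)) has_real_derivative 0) (at r within {0..1})" if r: "r \<in> {0..1}" for r
  proof -
    have g: "X r \<in> \<Omega>" "(X has_vector_derivative V r) (at r within {0..1})"
      "(V has_vector_derivative A r) (at r within {0..1})" "geo_eq (X r) (V r) (A r)"
      using X r unfolding geo_curve_def by auto
    note D = pdiff_chain[OF open_\<Omega> diff_coeff(1) g(1,2)] pdiff_chain[OF open_\<Omega> diff_coeff(2) g(1,2)]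
      pdiff_chain[OF open_\<Omega> diff_coeff(3) g(1,2)] has_vector_derivative_fst_snd[OF g(3)]
    have d: "((\<lambda>s. energy (X s) (V s)) has_real_derivative
      (fst (V r) * Eu (X r) + snd (V r) * Ev (X r)) * (fst (V r))\<^sup>2
    + 2 * (fst (V r) * Fu (X r) + snd (V r) * Fv (X r)) * fst (V r) * snd (V r)
    + (fst (V r) * Gu (X r) + snd (V r) * Gv (X r)) * (snd (V r))\<^sup>2
    + 2 * ip (X r) (V r) (A r)) (at r within {0..1})" (is "(_ has_real_derivative ?e) _")
      unfolding energy_def
      by (rule derivative_eq_intros D refl)+ (simp add: ip_def algebra_simps power2_eq_square)
    \<comment> \<open>By the geodesic equation the same expression is the derivative of twice the energy, so it vanishes.\<close>
    from ip_has_derivative[OF X r g(3)] have "((\<lambda>s. 2 * energy (X s) (V s)) has_real_derivative ?e) (at r within {0..1})"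
      unfolding energy_eq_ip .
    moreover have "((\<lambda>s. 2 * energy (X s) (V s)) has_real_derivative 2 * ?e) (at r within {0..1})"
      by (rule DERIV_cmult[OF d])
    ultimately have "?e = 2 * ?e"
      using vector_derivative_unique_within[of r "{0..1}"] r
      by (metis (no_types, lifting) has_real_derivative_iff_has_vector_derivative
        trivial_limit_within islimpt_Icc zero_less_one atLeastAtMost_iff)
    moreover have "x = 2 * x \<Longrightarrow> x = 0" for x :: real by simp
    ultimately have "?e = 0" by blast
    with d show ?thesis by (simp only:)
  qed
  then show ?thesis
    using has_field_derivative_zero_constant[of "{0..1}" "\<lambda>s. energy (X s) (V s)"] t by fastforce
qed

lemma curve_length_geo:
  assumes X: "geo_curve X V A"
  shows "curve_length E F G X = sqrt (energy (X 0) (V 0))"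
proof -
  have "curve_length E F G X = integral {0..1} (\<lambda>t::real. sqrt (energy (X 0) (V 0)))"
    unfolding curve_length_def
  proof (rule Henstock_Kurzweil_Integration.integral_cong)
    fix t :: real assume t: "t \<in> {0..1}"
    then have "vector_derivative X (at t within {0..1}) = V t"
      using X by (intro vector_derivative_within_closed_interval) (auto simp: geo_curve_def)
    then show "(let w = vector_derivative X (at t within {0..1}) in
      sqrt (E (X t) * (fst w)\<^sup>2 + 2 * F (X t) * fst w * snd w + G (X t) * (snd w)\<^sup>2)) = sqrt (energy (X 0) (V 0))"
      using energy_constant[OF X t, of 0] by (simp add: Let_def energy_def)
  qed
  then show ?thesis by simp
qed

lemma geo_curve_geodesic:
  assumes "geo_curve X V A" "continuous_on {0..1} A"
  shows "geodesic E F G X"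
  unfolding geodesic_def geodesic_equations_iff
  using assms unfolding geo_curve_def by (intro exI[of _ V] exI[of _ A]) auto

text \<open>The acceleration obtained from \<open>geo_eq\<close> by Cramer's rule, arranged as two
  quadratic forms in the velocity in the shape of \<open>quadratic_bound_form\<close>.\<close>

definition geo_rhs :: "pt \<Rightarrow> pt \<Rightarrow> pt" where
  "geo_rhs x v = (let D = 1 / (E x * G x - F x * F x) in
    (D * (F x * (Fu x - Ev x * (1/2)) - G x * (Eu x * (1/2))) * (fst v * fst v)
      + D * (F x * Gu x - G x * Ev x) * (fst v * snd v)
      + D * (F x * (Gv x * (1/2)) - G x * (Fv x - Gu x * (1/2))) * (snd v * snd v),
     D * (F x * (Eu x * (1/2)) - E x * (Fu x - Ev x * (1/2))) * (fst v * fst v)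
      + D * (F x * Ev x - E x * Gu x) * (fst v * snd v)
      + D * (F x * (Fv x - Gu x * (1/2)) - E x * (Gv x * (1/2))) * (snd v * snd v)))"

lemma geo_eq_geo_rhs:
  assumes "x \<in> \<Omega>" shows "geo_eq x v (geo_rhs x v)"
proof -
  define D where "D = 1 / (E x * G x - F x * F x)"
  have D: "(E x * G x - F x * F x) * D = 1" using posdef[OF assms] by (simp add: D_def power2_eq_square)
  define n0 where "n0 = Eu x / 2 * (fst v)\<^sup>2 + Ev x * fst v * snd v + (Fv x - Gu x / 2) * (snd v)\<^sup>2"
  define n1 where "n1 = (Fu x - Ev x / 2) * (fst v)\<^sup>2 + Gu x * fst v * snd v + Gv x / 2 * (snd v)\<^sup>2"
  have r: "geo_rhs x v = (D * (F x * n1 - G x * n0), D * (F x * n0 - E x * n1))"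
    unfolding geo_rhs_def Let_def D_def[symmetric] n0_def n1_def
    by (simp add: algebra_simps power2_eq_square)
  have "E x * (D * (F x * n1 - G x * n0)) + F x * (D * (F x * n0 - E x * n1)) = - n0 * ((E x * G x - F x * F x) * D)"
    "F x * (D * (F x * n1 - G x * n0)) + G x * (D * (F x * n0 - E x * n1)) = - n1 * ((E x * G x - F x * F x) * D)"
    by (simp_all add: algebra_simps)
  then show ?thesis
    unfolding geo_eq_def n0_def[symmetric] n1_def[symmetric] r D by simp
qed

text \<open>The determinant \<open>E * G - F * F\<close> attains a positive minimum on the compact
  set, so its reciprocal is bounded and Lipschitz like the other coefficients.\<close>

lemma quadratic_bound_geo_rhs:
  assumes K: "compact K" "convex K" "K \<subseteq> \<Omega>"
  shows "quadratic_bound K geo_rhs"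
proof (cases "K = {}")
  case False
  note b = bdd_lipschitz_smooth[OF open_\<Omega> _ K]
  note B = b[OF smooth(1)] b[OF smooth(2)] b[OF smooth(3)]
    b[OF smooth_fun_onD(2)[OF smooth(1)]] b[OF smooth_fun_onD(3)[OF smooth(1)]]
    b[OF smooth_fun_onD(2)[OF smooth(2)]] b[OF smooth_fun_onD(3)[OF smooth(2)]]
    b[OF smooth_fun_onD(2)[OF smooth(3)]] b[OF smooth_fun_onD(3)[OF smooth(3)]]
  have "continuous_on K (\<lambda>x. E x * G x - F x * F x)"
    by (intro continuous_intros continuous_on_subset[OF _ K(3)] smooth_fun_onD(4) smooth)
  from continuous_attains_inf[OF K(1) False this]
  obtain m where m: "m \<in> K" "\<And>x. x \<in> K \<Longrightarrow> E m * G m - F m * F m \<le> E x * G x - F x * F x"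
    by blast
  have "E m * G m - F m * F m > 0" using posdef[of m] m(1) K(3) by (auto simp: power2_eq_square)
  then have D: "bdd_lipschitz K (\<lambda>x. 1 / (E x * G x - F x * F x))"
    by (rule bdd_lipschitz_inverse[OF bdd_lipschitz_diff[OF bdd_lipschitz_mult[OF B(1,3)] bdd_lipschitz_mult[OF B(2,2)]]]) (rule m(2))
  show ?thesis
    unfolding geo_rhs_def Let_def
    by (rule quadratic_bound_Pair; rule quadratic_bound_form; (rule D B bdd_lipschitz_const | rule bdd_lipschitz_mult | rule bdd_lipschitz_diff)+)
qed (simp add: quadratic_bound_def, rule exI[of _ 1], simp)

end

subsection \<open>The first variation of energy\<close>

text \<open>\<open>De\<close> is the linear part of the change of \<open>e\<close>. What remains
  after removing all first-order terms is a Taylor error times a product, \<open>De\<close> times a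
  change of \<open>a * b\<close>, and \<open>e\<close> times two changes; each is quadratic in
  \<open>d\<close>. The constants add up to \<open>M\<^sup>2 + 4 * M + 1\<close>, below
  \<open>(M + 2)\<^sup>2\<close>.\<close>

lemma product_remainder_le:
  fixes e e' :: real
  assumes C: "0 \<le> C" and M: "0 \<le> M" and d: "0 \<le> d"
    and e: "\<bar>e\<bar> \<le> C" "\<bar>De\<bar> \<le> 2 * C * d" "\<bar>e' - e - De\<bar> \<le> C * d\<^sup>2"
    and ab: "\<bar>a\<bar> \<le> M" "\<bar>a'\<bar> \<le> M" "\<bar>b\<bar> \<le> M" "\<bar>b'\<bar> \<le> M" "\<bar>a' - a\<bar> \<le> d" "\<bar>b' - b\<bar> \<le> d"
  shows "\<bar>e' * (a' * b') - e * (a * b) - (De * (a * b) + e * ((a' - a) * b + a * (b' - b)))\<bar>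
    \<le> C * (M + 2)\<^sup>2 * d\<^sup>2"
proof -
  have ab': "\<bar>a' * b'\<bar> \<le> M * M" unfolding abs_mult by (intro mult_mono ab M) auto
  have "a' * b' - a * b = (a' - a) * b' + a * (b' - b)" by (simp add: algebra_simps)
  also have "\<bar>\<dots>\<bar> \<le> \<bar>a' - a\<bar> * \<bar>b'\<bar> + \<bar>a\<bar> * \<bar>b' - b\<bar>" by (metis abs_mult abs_triangle_ineq)
  also have "\<dots> \<le> d * M + M * d" by (intro add_mono mult_mono ab M d) auto
  finally have df: "\<bar>a' * b' - a * b\<bar> \<le> 2 * M * d" by simp
  have "e' * (a' * b') - e * (a * b) - (De * (a * b) + e * ((a' - a) * b + a * (b' - b)))
    = (e' - e - De) * (a' * b') + De * (a' * b' - a * b) + e * ((a' - a) * (b' - b))"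
    by (simp add: algebra_simps)
  also have "\<bar>\<dots>\<bar> \<le> \<bar>e' - e - De\<bar> * \<bar>a' * b'\<bar> + \<bar>De\<bar> * \<bar>a' * b' - a * b\<bar> + \<bar>e\<bar> * (\<bar>a' - a\<bar> * \<bar>b' - b\<bar>)"
    unfolding abs_mult[symmetric] by (intro order_trans[OF abs_triangle_ineq] add_right_mono abs_triangle_ineq)
  also have "\<dots> \<le> (C * d\<^sup>2) * (M * M) + (2 * C * d) * (2 * M * d) + C * (d * d)"
    using C M d by (intro add_mono mult_mono e ab ab' df) auto
  also have "\<dots> = C * (M + 2)\<^sup>2 * d\<^sup>2 - 3 * C * d\<^sup>2" by (simp add: power2_eq_square algebra_simps)
  also have "\<dots> \<le> C * (M + 2)\<^sup>2 * d\<^sup>2" using C by simp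
  finally show ?thesis .
qed

context surface
begin

text \<open>First-order expansion of \<open>energy\<close> in position and velocity with uniform
  quadratic error. Each of its three terms is a coefficient times two velocity components, so
  \<open>product_remainder_le\<close> applies with \<open>M = 4\<close>.\<close>

lemma energy_remainder:
  assumes K: "compact K" "convex K" "K \<subseteq> \<Omega>"
  shows "\<exists>c\<ge>0. \<forall>x\<in>K. \<forall>y\<in>K. \<forall>v w d. norm v \<le> 4 \<longrightarrow> norm w \<le> 4 \<longrightarrow> norm (y - x) \<le> d \<longrightarrow> norm (w - v) \<le> d \<longrightarrow>
    \<bar>energy y w - energy x v
      - ((fst (y - x) * Eu x + snd (y - x) * Ev x) * (fst v)\<^sup>2
       + 2 * (fst (y - x) * Fu x + snd (y - x) * Fv x) * fst v * snd v
       + (fst (y - x) * Gu x + snd (y - x) * Gv x) * (snd v)\<^sup>2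
       + 2 * ip x v (w - v))\<bar> \<le> c * d\<^sup>2"
proof -
  let ?D = "\<lambda>f x z. fst z * pdiff 0 f x + snd z * pdiff (Suc 0) f x"
  have T: "\<exists>C\<ge>0. \<forall>x\<in>K. \<forall>y\<in>K. \<bar>f x\<bar> \<le> C \<and> \<bar>pdiff 0 f x\<bar> \<le> C \<and> \<bar>pdiff (Suc 0) f x\<bar> \<le> C \<and>
    \<bar>f y - f x - ?D f x (y - x)\<bar> \<le> C * (norm (y - x))\<^sup>2" if "smooth_fun_on \<Omega> f" for f
    using taylor_smooth[OF open_\<Omega> that K] .
  define R where "R f x y v w l m = f y * (l w * m w) - f x * (l v * m v)
    - (?D f x (y - x) * (l v * m v) + f x * ((l w - l v) * m v + l v * (m w - m v)))"
    for f and x y v w :: pt and l m :: "pt \<Rightarrow> real"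
  have B: "\<exists>c\<ge>0. \<forall>x\<in>K. \<forall>y\<in>K. \<forall>v w d. norm v \<le> 4 \<longrightarrow> norm w \<le> 4 \<longrightarrow> norm (y - x) \<le> d \<longrightarrow> norm (w - v) \<le> d \<longrightarrow>
      \<bar>R f x y v w l m\<bar> \<le> c * d\<^sup>2"
    if f: "smooth_fun_on \<Omega> f" and l: "l = fst \<or> l = snd" and m: "m = fst \<or> m = snd" for f l m
  proof -
    obtain C where C: "C \<ge> 0" "\<And>x y. x \<in> K \<Longrightarrow> y \<in> K \<Longrightarrow> \<bar>f x\<bar> \<le> C \<and> \<bar>pdiff 0 f x\<bar> \<le> C \<and> \<bar>pdiff (Suc 0) f x\<bar> \<le> C \<and>
      \<bar>f y - f x - ?D f x (y - x)\<bar> \<le> C * (norm (y - x))\<^sup>2"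
      using T[OF f] by blast
    have L: "\<bar>l v\<bar> \<le> norm v" "\<bar>m v\<bar> \<le> norm v" "l (w - v) = l w - l v" "m (w - v) = m w - m v" for v w
      using l m by (auto intro: abs_fst_le_norm abs_snd_le_norm)
    show ?thesis
    proof (intro exI[of _ "C * (4 + 2)\<^sup>2"] conjI ballI allI impI)
      fix x y v w :: pt and d :: real
      assume a: "x \<in> K" "y \<in> K" "norm v \<le> 4" "norm w \<le> 4" "norm (y - x) \<le> d" "norm (w - v) \<le> d"
      have d: "0 \<le> d" using a(5) norm_ge_zero order_trans by blast
      have 1: "\<bar>f x\<bar> \<le> C" using C(2)[OF a(1,2)] by blast
      have "\<bar>?D f x (y - x)\<bar> \<le> \<bar>fst (y - x)\<bar> * \<bar>pdiff 0 f x\<bar> + \<bar>snd (y - x)\<bar> * \<bar>pdiff (Suc 0) f x\<bar>"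
        unfolding abs_mult[symmetric] by (rule abs_triangle_ineq)
      also have "\<dots> \<le> d * C + d * C"
        using C a d abs_fst_le_norm[of "y - x"] abs_snd_le_norm[of "y - x"] by (intro add_mono mult_mono) auto
      finally have 2: "\<bar>?D f x (y - x)\<bar> \<le> 2 * C * d" by simp
      have "\<bar>f y - f x - ?D f x (y - x)\<bar> \<le> C * (norm (y - x))\<^sup>2" using C(2)[OF a(1,2)] by blast
      also have "\<dots> \<le> C * d\<^sup>2" using a(5) C(1) by (intro mult_left_mono power_mono) auto
      finally have 3: "\<bar>f y - f x - ?D f x (y - x)\<bar> \<le> C * d\<^sup>2" .
      show "\<bar>R f x y v w l m\<bar> \<le> C * (4 + 2)\<^sup>2 * d\<^sup>2"
        unfolding R_def
        by (rule product_remainder_le[OF C(1) _ d 1 2 3])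
          (use L(1,2)[of v] L(1,2)[of w] L(1,2)[of "w - v"] L(3,4)[of w v] a in linarith)+
    qed (use C in auto)
  qed
  obtain c1 where c1: "c1 \<ge> 0" "\<And>x y v w d. x \<in> K \<Longrightarrow> y \<in> K \<Longrightarrow> norm v \<le> 4 \<Longrightarrow> norm w \<le> 4 \<Longrightarrow> norm (y - x) \<le> d \<Longrightarrow> norm (w - v) \<le> d \<Longrightarrow>
      \<bar>R E x y v w fst fst\<bar> \<le> c1 * d\<^sup>2" using B[OF smooth(1), of fst fst] by blast
  obtain c2 where c2: "c2 \<ge> 0" "\<And>x y v w d. x \<in> K \<Longrightarrow> y \<in> K \<Longrightarrow> norm v \<le> 4 \<Longrightarrow> norm w \<le> 4 \<Longrightarrow> norm (y - x) \<le> d \<Longrightarrow> norm (w - v) \<le> d \<Longrightarrow>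
      \<bar>R F x y v w fst snd\<bar> \<le> c2 * d\<^sup>2" using B[OF smooth(2), of fst snd] by blast
  obtain c3 where c3: "c3 \<ge> 0" "\<And>x y v w d. x \<in> K \<Longrightarrow> y \<in> K \<Longrightarrow> norm v \<le> 4 \<Longrightarrow> norm w \<le> 4 \<Longrightarrow> norm (y - x) \<le> d \<Longrightarrow> norm (w - v) \<le> d \<Longrightarrow>
      \<bar>R G x y v w snd snd\<bar> \<le> c3 * d\<^sup>2" using B[OF smooth(3), of snd snd] by blast
  show ?thesis
  proof (intro exI[of _ "c1 + 2 * c2 + c3"] conjI ballI allI impI)
    fix x y v w :: pt and d :: real
    assume a: "x \<in> K" "y \<in> K" "norm v \<le> 4" "norm w \<le> 4" "norm (y - x) \<le> d" "norm (w - v) \<le> d"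
    have "energy y w - energy x v - (?D E x (y - x) * (fst v)\<^sup>2 + 2 * ?D F x (y - x) * fst v * snd v
       + ?D G x (y - x) * (snd v)\<^sup>2 + 2 * ip x v (w - v))
      = R E x y v w fst fst + 2 * R F x y v w fst snd + R G x y v w snd snd"
      unfolding R_def energy_def ip_def by (simp add: power2_eq_square algebra_simps)
    also have "\<bar>\<dots>\<bar> \<le> \<bar>R E x y v w fst fst\<bar> + 2 * \<bar>R F x y v w fst snd\<bar> + \<bar>R G x y v w snd snd\<bar>" by linarith
    also have "\<dots> \<le> c1 * d\<^sup>2 + 2 * (c2 * d\<^sup>2) + c3 * d\<^sup>2"
      using c1(2)[OF a] c2(2)[OF a] c3(2)[OF a] by linarith
    also have "\<dots> = (c1 + 2 * c2 + c3) * d\<^sup>2" by (simp add: algebra_simps)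
    finally show "\<bar>energy y w - energy x v - (?D E x (y - x) * (fst v)\<^sup>2 + 2 * ?D F x (y - x) * fst v * snd v
       + ?D G x (y - x) * (snd v)\<^sup>2 + 2 * ip x v (w - v))\<bar> \<le> (c1 + 2 * c2 + c3) * d\<^sup>2" .
  qed (use c1 c2 c3 in auto)
qed

text \<open>The change of energy is, up to a quadratic error, given by boundary terms. Along the
  base geodesic the linear part of the change is the derivative of \<open>2 * ip\<close> of velocity
  and displacement, by \<open>ip_has_derivative\<close>; the mean value inequality then takes the
  place of integration.\<close>

lemma first_variation:
  assumes K: "compact K" "convex K" "K \<subseteq> \<Omega>"
  obtains c where "c \<ge> 0" "\<And>X V A Y W B d. geo_curve X V A \<Longrightarrow> geo_curve Y W B \<Longrightarrow>
    (\<And>t. t \<in> {0..1} \<Longrightarrow> X t \<in> K \<and> Y t \<in> K \<and> norm (V t) \<le> 4 \<and> norm (W t) \<le> 4 \<and>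
      norm (Y t - X t) \<le> d \<and> norm (W t - V t) \<le> d) \<Longrightarrow>
    \<bar>energy (Y 0) (W 0) - energy (X 0) (V 0) - (2 * ip (X 1) (V 1) (Y 1 - X 1) - 2 * ip (X 0) (V 0) (Y 0 - X 0))\<bar> \<le> c * d\<^sup>2"
proof -
  obtain c where c: "c \<ge> 0" "\<And>x y v w d. x \<in> K \<Longrightarrow> y \<in> K \<Longrightarrow> norm v \<le> 4 \<Longrightarrow> norm w \<le> 4 \<Longrightarrow> norm (y - x) \<le> d \<Longrightarrow> norm (w - v) \<le> d \<Longrightarrow>
    \<bar>energy y w - energy x v
      - ((fst (y - x) * Eu x + snd (y - x) * Ev x) * (fst v)\<^sup>2
       + 2 * (fst (y - x) * Fu x + snd (y - x) * Fv x) * fst v * snd v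
       + (fst (y - x) * Gu x + snd (y - x) * Gv x) * (snd v)\<^sup>2
       + 2 * ip x v (w - v))\<bar> \<le> c * d\<^sup>2"
    using energy_remainder[OF K] by blast
  show ?thesis
  proof (rule that[OF c(1)])
    fix X V A Y W B :: "real \<Rightarrow> pt" and d :: real
    assume X: "geo_curve X V A" and Y: "geo_curve Y W B"
      and H: "\<And>t. t \<in> {0..1} \<Longrightarrow> X t \<in> K \<and> Y t \<in> K \<and> norm (V t) \<le> 4 \<and> norm (W t) \<le> 4 \<and>
        norm (Y t - X t) \<le> d \<and> norm (W t - V t) \<le> d"
    let ?S = "energy (Y 0) (W 0) - energy (X 0) (V 0)"
    let ?D = "\<lambda>f t. fst (Y t - X t) * pdiff 0 f (X t) + snd (Y t - X t) * pdiff (Suc 0) f (X t)"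
    define \<phi>' where "\<phi>' t = ?D E t * (fst (V t))\<^sup>2 + 2 * ?D F t * fst (V t) * snd (V t) + ?D G t * (snd (V t))\<^sup>2
      + 2 * ip (X t) (V t) (W t - V t)" for t
    \<comment> \<open>Chosen so that its increment from 0 to 1 is exactly the quantity to be
      bounded.\<close>
    define \<psi> where "\<psi> t = t * ?S - 2 * ip (X t) (V t) (Y t - X t)" for t
    have "(\<psi> has_real_derivative ?S - \<phi>' t) (at t within {0..1})" if t: "t \<in> {0..1}" for t
    proof -
      have "((\<lambda>s. Y s - X s) has_vector_derivative W t - V t) (at t within {0..1})"
        using X Y t unfolding geo_curve_def by (intro has_vector_derivative_diff) auto
      from ip_has_derivative[OF X t this]
      have "((\<lambda>s. 2 * ip (X s) (V s) (Y s - X s)) has_real_derivative \<phi>' t) (at t within {0..1})"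
        unfolding \<phi>'_def .
      moreover have "((\<lambda>t. t * ?S) has_real_derivative ?S) (at t within {0..1})"
        by (rule derivative_eq_intros refl | simp)+
      ultimately show ?thesis unfolding \<psi>_def[abs_def] by (intro DERIV_diff)
    qed
    \<comment> \<open>Energy is constant along both curves, so \<open>?S\<close> is also the energy
      difference at time \<open>t\<close>, and the expansion there applies.\<close>
    moreover have "norm (?S - \<phi>' t) \<le> c * d\<^sup>2" if t: "t \<in> {0..1}" for t
      using c(2)[of "X t" "Y t" "V t" "W t" d] H[OF t] energy_constant[OF X t, of 0] energy_constant[OF Y t, of 0]
      unfolding \<phi>'_def real_norm_def by simp
    ultimately have "norm (\<psi> 1 - \<psi> 0) \<le> c * d\<^sup>2 * norm (1 - 0 :: real)"
      by (intro field_differentiable_bound[where S = "{0..1}" and f' = "\<lambda>t. ?S - \<phi>' t"]) auto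
    then show "\<bar>?S - (2 * ip (X 1) (V 1) (Y 1 - X 1) - 2 * ip (X 0) (V 0) (Y 0 - X 0))\<bar> \<le> c * d\<^sup>2"
      unfolding \<psi>_def by (simp add: algebra_simps)
  qed
qed

text \<open>Combines the boundary value problem with the first variation formula. In the constant
  \<open>8 * C + 4 * c\<close>, the first summand serves the comparison with the chord, the second
  the variation, where the factor 2 of \<open>Q.dependence\<close> is squared.\<close>

lemma geodesic_family:
  assumes r: "r > 0" "cball p r \<subseteq> \<Omega>"
  obtains h c X V where "h > 0" "c \<ge> 0"
    "\<And>a b. a \<in> ball p h \<Longrightarrow> b \<in> ball p h \<Longrightarrow> \<exists>A. geo_curve (X a b) (V a b) A \<and> continuous_on {0..1} A"
    "\<And>a b. a \<in> ball p h \<Longrightarrow> b \<in> ball p h \<Longrightarrow> X a b 0 = a \<and> X a b 1 = b \<and> X a b ` {0..1} \<subseteq> ball p r"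
    "\<And>a b t. a \<in> ball p h \<Longrightarrow> b \<in> ball p h \<Longrightarrow> t \<in> {0..1} \<Longrightarrow> norm (V a b t - (b - a)) \<le> c * (norm (b - a))\<^sup>2"
    "\<And>a b a' b'. a \<in> ball p h \<Longrightarrow> b \<in> ball p h \<Longrightarrow> a' \<in> ball p h \<Longrightarrow> b' \<in> ball p h \<Longrightarrow>
      \<bar>energy a' (V a' b' 0) - energy a (V a b 0) - (2 * ip b (V a b 1) (b' - b) - 2 * ip a (V a b 0) (a' - a))\<bar>
      \<le> c * (norm (a' - a) + norm (b' - b))\<^sup>2"
proof -
  note K = compact_cball[of p r] convex_cball[of p r] r(2)
  obtain C where C: "C > 0" "\<And>x v s. x \<in> cball p r \<Longrightarrow> norm v \<le> s \<Longrightarrow> norm (geo_rhs x v) \<le> C * s\<^sup>2"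
    "\<And>x y v w s. x \<in> cball p r \<Longrightarrow> y \<in> cball p r \<Longrightarrow> norm v \<le> s \<Longrightarrow> norm w \<le> s \<Longrightarrow>
        norm (geo_rhs x v - geo_rhs y w) \<le> C * (s\<^sup>2 * norm (x - y) + s * norm (v - w))"
    by (rule quadratic_boundE[OF quadratic_bound_geo_rhs[OF K]]) (rule that)
  interpret Q: quadratic_ode p r C geo_rhs
    by (rule quadratic_ode.intro[OF r(1) C(1)])
      (erule C(2)[OF subsetD[OF ball_subset_cball]] C(3)[OF subsetD[OF ball_subset_cball] subsetD[OF ball_subset_cball]], assumption+)+
  obtain c where c: "c \<ge> 0" "\<And>X V A Y W B d. geo_curve X V A \<Longrightarrow> geo_curve Y W B \<Longrightarrow>
    (\<And>t. t \<in> {0..1} \<Longrightarrow> X t \<in> cball p r \<and> Y t \<in> cball p r \<and> norm (V t) \<le> 4 \<and> norm (W t) \<le> 4 \<and>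
      norm (Y t - X t) \<le> d \<and> norm (W t - V t) \<le> d) \<Longrightarrow>
    \<bar>energy (Y 0) (W 0) - energy (X 0) (V 0) - (2 * ip (X 1) (V 1) (Y 1 - X 1) - 2 * ip (X 0) (V 0) (Y 0 - X 0))\<bar> \<le> c * d\<^sup>2"
  proof (rule first_variation[OF K], goal_cases)
    case (1 c)
    from 1(2,3) show ?case by (rule 1(1))
  qed
  have geo: "geo_curve (Q.pos a b) (Q.vel a b) (Q.acc a b)" if ab: "a \<in> ball p Q.h" "b \<in> ball p Q.h" for a b
    unfolding geo_curve_def
  proof (intro ballI conjI)
    fix t :: real assume t: "t \<in> {0..1}"
    show \<Omega>: "Q.pos a b t \<in> \<Omega>" using Q.solution(5)[OF ab t] r by auto
    show "geo_eq (Q.pos a b t) (Q.vel a b t) (Q.acc a b t)"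
      unfolding Q.acc(3)[OF ab t] by (rule geo_eq_geo_rhs[OF \<Omega>])
  qed (use Q.solution[OF ab] in auto)
  \<comment> \<open>Speeds are at most \<open>4 * h\<close> with \<open>h \<le> 1\<close>; this is
    the velocity bound 4 that \<open>first_variation\<close> asks for.\<close>
  have vel4: "norm (Q.vel a b t) \<le> 4" if ab: "a \<in> ball p Q.h" "b \<in> ball p Q.h" and t: "t \<in> {0..1}" for a b t
    using Q.bounds(2)[OF ab Q.acc(1)[OF ab] Q.acc(2)[OF ab] t] Q.h(2) unfolding Q.vel_def by linarith
  have "\<bar>energy a' (Q.vel a' b' 0) - energy a (Q.vel a b 0) - (2 * ip b (Q.vel a b 1) (b' - b) - 2 * ip a (Q.vel a b 0) (a' - a))\<bar>
      \<le> (8 * C + 4 * c) * (norm (a' - a) + norm (b' - b))\<^sup>2"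
    if ab: "a \<in> ball p Q.h" "b \<in> ball p Q.h" and ab': "a' \<in> ball p Q.h" "b' \<in> ball p Q.h" for a b a' b'
  proof -
    have "\<bar>energy (Q.pos a' b' 0) (Q.vel a' b' 0) - energy (Q.pos a b 0) (Q.vel a b 0)
      - (2 * ip (Q.pos a b 1) (Q.vel a b 1) (Q.pos a' b' 1 - Q.pos a b 1)
        - 2 * ip (Q.pos a b 0) (Q.vel a b 0) (Q.pos a' b' 0 - Q.pos a b 0))\<bar>
      \<le> c * (2 * (norm (a' - a) + norm (b' - b)))\<^sup>2"
      by (rule c(2)[OF geo[OF ab] geo[OF ab']])
        (intro ab ab' conjI vel4 Q.dependence subsetD[OF ball_subset_cball] Q.solution)
    also have "\<dots> \<le> (8 * C + 4 * c) * (norm (a' - a) + norm (b' - b))\<^sup>2"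
      unfolding power_mult_distrib using C(1) by (simp add: distrib_right)
    finally show ?thesis by (simp only: Q.solution(1,2)[OF ab] Q.solution(1,2)[OF ab'])
  qed
  moreover have "norm (Q.vel a b t - (b - a)) \<le> (8 * C + 4 * c) * (norm (b - a))\<^sup>2"
    if "a \<in> ball p Q.h" "b \<in> ball p Q.h" "t \<in> {0..1}" for a b t
    using Q.vel_approx[OF that] c(1) by (simp add: distrib_right add_increasing2)
  ultimately show ?thesis
    using geo Q.acc(1) Q.h(1) C(1) c(1) Q.solution(1,2,5)
    by (intro that[of Q.h "8 * C + 4 * c" Q.pos Q.vel] conjI image_subsetI exI) simp_all
qed

end

subsection \<open>Separation of variables\<close>

lemma zero_derivative_imp_eq:
  fixes f :: "real \<Rightarrow> real"
  assumes "convex I" "\<And>x. x \<in> I \<Longrightarrow> (f has_real_derivative 0) (at x)" "x \<in> I" "y \<in> I"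
  shows "f x = f y"
  using has_field_derivative_zero_constant[OF assms(1), of f] assms(2-4)
  by (metis has_field_derivative_at_within)

text \<open>The equations say that \<open>\<rho>\<^sub>v / \<rho>\<close> and
  \<open>e\<^sub>v / \<rho>\<close> do not depend on \<open>u\<close>. The first splits
  \<open>\<rho>\<close> into a function \<open>A\<close> of \<open>u\<close> times a function of
  \<open>v\<close>. The second then gives \<open>e\<^sub>v u v = A u * e\<^sub>v u0 v\<close>, so
  \<open>e u v - A u * e u0 v\<close> does not depend on \<open>v\<close>.\<close>

lemma separation:
  fixes I J :: "real set" and e e\<^sub>v e\<^sub>u\<^sub>v \<rho> \<rho>\<^sub>u \<rho>\<^sub>v \<rho>\<^sub>u\<^sub>v :: "real \<Rightarrow> real \<Rightarrow> real"
  assumes I: "convex I" "u0 \<in> I" and J: "convex J" "v0 \<in> J"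
    and pos: "\<And>u v. u \<in> I \<Longrightarrow> v \<in> J \<Longrightarrow> \<rho> u v > 0"
    and e: "\<And>u v. u \<in> I \<Longrightarrow> v \<in> J \<Longrightarrow> ((\<lambda>w. e u w) has_real_derivative e\<^sub>v u v) (at v)"
      "\<And>u v. u \<in> I \<Longrightarrow> v \<in> J \<Longrightarrow> ((\<lambda>w. e\<^sub>v w v) has_real_derivative e\<^sub>u\<^sub>v u v) (at u)"
    and \<rho>: "\<And>u v. u \<in> I \<Longrightarrow> v \<in> J \<Longrightarrow> ((\<lambda>w. \<rho> w v) has_real_derivative \<rho>\<^sub>u u v) (at u)"
      "\<And>u v. u \<in> I \<Longrightarrow> v \<in> J \<Longrightarrow> ((\<lambda>w. \<rho> u w) has_real_derivative \<rho>\<^sub>v u v) (at v)"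
      "\<And>u v. u \<in> I \<Longrightarrow> v \<in> J \<Longrightarrow> ((\<lambda>w. \<rho>\<^sub>v w v) has_real_derivative \<rho>\<^sub>u\<^sub>v u v) (at u)"
    and pde: "\<And>u v. u \<in> I \<Longrightarrow> v \<in> J \<Longrightarrow> \<rho> u v * \<rho>\<^sub>u\<^sub>v u v = \<rho>\<^sub>u u v * \<rho>\<^sub>v u v"
      "\<And>u v. u \<in> I \<Longrightarrow> v \<in> J \<Longrightarrow> \<rho> u v * e\<^sub>u\<^sub>v u v = \<rho>\<^sub>u u v * e\<^sub>v u v"
  shows "\<exists>U1 U2 V1 V2. \<forall>u\<in>I. \<forall>v\<in>J. e u v = (U1 u - V1 v) * U2 u \<and> e u v / \<rho> u v = (U1 u - V1 v) * V2 v"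
proof -
  \<comment> \<open>Used twice, with \<open>g\<close> being \<open>\<rho>\<^sub>v\<close> and
    \<open>e\<^sub>v\<close>: the hypothesis on \<open>g'\<close> is the vanishing of the numerator
    in the quotient rule.\<close>
  have quot: "g u v / \<rho> u v = g u0 v / \<rho> u0 v"
    if g: "\<And>u v. u \<in> I \<Longrightarrow> v \<in> J \<Longrightarrow> ((\<lambda>w. g w v) has_real_derivative g' u v) (at u)"
      "\<And>u v. u \<in> I \<Longrightarrow> v \<in> J \<Longrightarrow> \<rho> u v * g' u v = \<rho>\<^sub>u u v * g u v" and uv: "u \<in> I" "v \<in> J"
    for g g' u v
  proof (rule zero_derivative_imp_eq[OF I(1) _ uv(1) I(2), where f = "\<lambda>w. g w v / \<rho> w v"])
    fix w assume w: "w \<in> I"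
    show "((\<lambda>w. g w v / \<rho> w v) has_real_derivative 0) (at w)"
      by (rule derivative_eq_intros g(1)[OF w uv(2)] \<rho>(1)[OF w uv(2)] refl)+
        (use pos[OF w uv(2)] g(2)[OF w uv(2)] in \<open>auto simp: algebra_simps\<close>)
  qed
  have \<rho>_split: "\<rho> u v / \<rho> u0 v = \<rho> u v0 / \<rho> u0 v0" if uv: "u \<in> I" "v \<in> J" for u v
  proof (rule zero_derivative_imp_eq[OF J(1) _ uv(2) J(2), where f = "\<lambda>w. \<rho> u w / \<rho> u0 w"])
    fix w assume w: "w \<in> J"
    have "\<rho>\<^sub>v u w / \<rho> u w = \<rho>\<^sub>v u0 w / \<rho> u0 w" by (rule quot[OF \<rho>(3) pde(1) uv(1) w])
    then have "\<rho>\<^sub>v u w * \<rho> u0 w = \<rho> u w * \<rho>\<^sub>v u0 w"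
      using pos[OF uv(1) w] pos[OF I(2) w] by (simp add: field_simps)
    then show "((\<lambda>w. \<rho> u w / \<rho> u0 w) has_real_derivative 0) (at w)"
      using pos[OF I(2) w] by (auto intro!: derivative_eq_intros \<rho>(2) uv(1) w I(2))
  qed
  define A where "A u = \<rho> u v0 / \<rho> u0 v0" for u
  have A: "A u > 0" if "u \<in> I" for u unfolding A_def using pos that I J by simp
  have \<rho>A: "\<rho> u v = A u * \<rho> u0 v" if "u \<in> I" "v \<in> J" for u v
    using \<rho>_split[OF that] pos[OF I(2) that(2)] by (simp add: A_def field_simps)
  have e_split: "e u v - A u * e u0 v = e u v0 - A u * e u0 v0" if uv: "u \<in> I" "v \<in> J" for u v
  proof (rule zero_derivative_imp_eq[OF J(1) _ uv(2) J(2), where f = "\<lambda>w. e u w - A u * e u0 w"])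
    fix w assume w: "w \<in> J"
    have "e\<^sub>v u w / \<rho> u w = e\<^sub>v u0 w / \<rho> u0 w" by (rule quot[OF e(2) pde(2) uv(1) w])
    then have "e\<^sub>v u w = A u * e\<^sub>v u0 w"
      using A[OF uv(1)] pos[OF I(2) w] by (simp add: \<rho>A[OF uv(1) w] field_simps)
    then show "((\<lambda>w. e u w - A u * e u0 w) has_real_derivative 0) (at w)"
      by (auto intro!: derivative_eq_intros e(1) uv(1) w I(2))
  qed
  show ?thesis
  \<comment> \<open>The witnesses, fixed by the equations shown below, are
    \<open>e u v0 / A u\<close> for \<open>U1\<close>, \<open>A\<close> for \<open>U2\<close>,
    \<open>e u0 v0 - e u0 v\<close> for \<open>V1\<close> and \<open>1 / \<rho> u0 v\<close> for
    \<open>V2\<close>.\<close>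
  proof (intro exI ballI conjI)
    fix u v assume uv: "u \<in> I" "v \<in> J"
    have "e u v = e u v0 - (e u0 v0 - e u0 v) * A u"
      using e_split[OF uv] by (simp add: algebra_simps)
    then show *: "e u v = (e u v0 / A u - (e u0 v0 - e u0 v)) * A u"
      using A[OF uv(1)] by (simp add: left_diff_distrib)
    show "e u v / \<rho> u v = (e u v0 / A u - (e u0 v0 - e u0 v)) * (1 / \<rho> u0 v)"
      unfolding \<rho>A[OF uv] by (subst *) (use A[OF uv(1)] in simp)
  qed
qed

text \<open>Two applications of the mean value theorem, first in \<open>v\<close> to the difference
  across the \<open>u\<close>-side and then in \<open>u\<close> to \<open>f\<^sub>v\<close>, turn
  the second difference into \<open>s * (s * \<alpha>)\<close> times a value of
  \<open>f\<^sub>u\<^sub>v\<close> inside the rectangle; continuity finishes.\<close>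

lemma mixed_difference_limit:
  fixes f f\<^sub>v f\<^sub>u\<^sub>v :: "real \<Rightarrow> real \<Rightarrow> real"
  assumes I: "open I" "convex I" "u \<in> I" and J: "open J" "convex J" "v \<in> J" and \<alpha>: "\<alpha> > 0"
    and f: "\<And>u v. u \<in> I \<Longrightarrow> v \<in> J \<Longrightarrow> ((\<lambda>w. f u w) has_real_derivative f\<^sub>v u v) (at v)"
      "\<And>u v. u \<in> I \<Longrightarrow> v \<in> J \<Longrightarrow> ((\<lambda>w. f\<^sub>v w v) has_real_derivative f\<^sub>u\<^sub>v u v) (at u)"
    and cont: "isCont (\<lambda>q. f\<^sub>u\<^sub>v (fst q) (snd q)) (u, v)"
  shows "((\<lambda>s. (f (u + s * \<alpha>) (v + s) - f (u + s * \<alpha>) v - f u (v + s) + f u v) / s\<^sup>2) \<longlongrightarrow> \<alpha> * f\<^sub>u\<^sub>v u v) (at_right 0)"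
proof -
  have evI: "\<forall>\<^sub>F s in at_right 0. u + s * \<alpha> \<in> I"
    by (rule topological_tendstoD[OF _ I(1), where l = u]) (auto intro!: tendsto_eq_intros I(3))
  have evJ: "\<forall>\<^sub>F s in at_right 0. v + s \<in> J"
    by (rule topological_tendstoD[OF _ J(1), where l = v]) (auto intro!: tendsto_eq_intros J(3))
  have key: "\<exists>x y. x \<in> {u..u + s * \<alpha>} \<and> y \<in> {v..v + s} \<and>
      (f (u + s * \<alpha>) (v + s) - f (u + s * \<alpha>) v - f u (v + s) + f u v) / s\<^sup>2 = \<alpha> * f\<^sub>u\<^sub>v x y"
    if s: "s > 0" "u + s * \<alpha> \<in> I" "v + s \<in> J" for s
  proof -
    have subI: "{u..u + s * \<alpha>} \<subseteq> I" "{v..v + s} \<subseteq> J"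
      using s I J convex_contains_segment closed_segment_eq_real_ivl1
      by (smt (verit) \<alpha> mult_pos_pos closed_segment_eq_real_ivl)+
    have sa: "u < u + s * \<alpha>" using s \<alpha> by simp
    have "\<exists>y>v. y < v + s \<and> (f (u + s * \<alpha>) (v + s) - f u (v + s)) - (f (u + s * \<alpha>) v - f u v) = (v + s - v) * (f\<^sub>v (u + s * \<alpha>) y - f\<^sub>v u y)"
      using s subI I(3)
      by (intro MVT2[where f = "\<lambda>w. f (u + s * \<alpha>) w - f u w"]) (auto intro!: DERIV_diff f)
    then obtain y where y: "v < y" "y < v + s"
      "(f (u + s * \<alpha>) (v + s) - f u (v + s)) - (f (u + s * \<alpha>) v - f u v) = s * (f\<^sub>v (u + s * \<alpha>) y - f\<^sub>v u y)" by auto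
    then have yJ: "y \<in> J" using subI by auto
    have "\<exists>x>u. x < u + s * \<alpha> \<and> f\<^sub>v (u + s * \<alpha>) y - f\<^sub>v u y = (u + s * \<alpha> - u) * f\<^sub>u\<^sub>v x y"
      using sa subI yJ by (intro MVT2) (auto intro!: f)
    then obtain x where x: "u < x" "x < u + s * \<alpha>" "f\<^sub>v (u + s * \<alpha>) y - f\<^sub>v u y = s * \<alpha> * f\<^sub>u\<^sub>v x y" by auto
    have "f (u + s * \<alpha>) (v + s) - f (u + s * \<alpha>) v - f u (v + s) + f u v = s * (s * \<alpha> * f\<^sub>u\<^sub>v x y)"
      using y(3) x(3) by simp
    then have "(f (u + s * \<alpha>) (v + s) - f (u + s * \<alpha>) v - f u (v + s) + f u v) / s\<^sup>2 = \<alpha> * f\<^sub>u\<^sub>v x y"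
      using s(1) by (simp add: power2_eq_square)
    then show ?thesis using x y by (intro exI[of _ x] exI[of _ y]) auto
  qed
  show ?thesis
  proof (rule tendstoI)
    fix \<epsilon> :: real assume \<epsilon>: "\<epsilon> > 0"
    have "isCont (\<lambda>q. \<alpha> * f\<^sub>u\<^sub>v (fst q) (snd q)) (u, v)" by (intro continuous_intros cont)
    then obtain \<delta> where \<delta>: "\<delta> > 0" "\<And>q. dist q (u, v) < \<delta> \<Longrightarrow> dist (\<alpha> * f\<^sub>u\<^sub>v (fst q) (snd q)) (\<alpha> * f\<^sub>u\<^sub>v u v) < \<epsilon>"
      using \<epsilon> unfolding continuous_at_eps_delta by (metis dist_norm fst_conv snd_conv)
    have "\<forall>\<^sub>F s in at_right 0. s * \<alpha> + s < \<delta>"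
      by (rule order_tendstoD(2)[of _ 0]) (auto intro!: tendsto_eq_intros \<delta>)
    with evI evJ eventually_at_right_less[of 0]
    show "\<forall>\<^sub>F s in at_right 0. dist ((f (u + s * \<alpha>) (v + s) - f (u + s * \<alpha>) v - f u (v + s) + f u v) / s\<^sup>2) (\<alpha> * f\<^sub>u\<^sub>v u v) < \<epsilon>"
    proof eventually_elim
      case (elim s)
      from key[OF elim(3,1,2)] obtain x y where xy: "x \<in> {u..u + s * \<alpha>}" "y \<in> {v..v + s}"
        "(f (u + s * \<alpha>) (v + s) - f (u + s * \<alpha>) v - f u (v + s) + f u v) / s\<^sup>2 = \<alpha> * f\<^sub>u\<^sub>v x y" by blast
      have "dist (x, y) (u, v) \<le> \<bar>x - u\<bar> + \<bar>y - v\<bar>"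
        unfolding dist_Pair_Pair by (simp add: dist_real_def sqrt_sum_squares_le_sum_abs)
      also have "\<dots> < \<delta>" using xy elim by auto
      finally show ?case using \<delta>(2)[of "(x, y)"] xy(3) by simp
    qed
  qed
qed

subsection \<open>Consequences of the Ivory property\<close>

lemma linear_le_quadratic_imp_zero:
  fixes x C :: real
  assumes "\<forall>\<^sub>F s in at_right 0. \<bar>s * x\<bar> \<le> C * s\<^sup>2"
  shows "x = 0"
proof -
  have "\<forall>\<^sub>F s in at_right 0. \<bar>x\<bar> \<le> C * s"
    using assms eventually_at_right_less[of 0]
    by eventually_elim (simp add: abs_mult power2_eq_square mult.left_commute)
  moreover have "((\<lambda>s. C * s) \<longlongrightarrow> C * 0) (at_right 0)" by (intro tendsto_intros)
  ultimately have "\<bar>x\<bar> \<le> C * 0" by (intro tendsto_lowerbound) auto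
  then show ?thesis by simp
qed

text \<open>Subtracting the equations of corners 22 and 21 removes \<open>b\<close>, those of 12 and
  11 removes \<open>a\<close>; weighting the differences by \<open>r11\<close> and
  \<open>r21\<close> removes \<open>c\<close>. The result is written with second differences and
  products of first differences so that every bracket is of order \<open>s\<^sup>2\<close> on a
  rectangle of size \<open>s\<close>.\<close>

lemma corner_relation:
  fixes E11 E12 E21 E22 r11 r12 r21 r22 S :: real
  assumes "a + c * r11 = S * E11" "b + d * r22 = S * E22" "a + d * r12 = S * E12" "b + c * r21 = S * E21"
  shows "d * (r11 * (r22 - r21 - r12 + r11) - (r21 - r11) * (r12 - r11))
    = S * (r11 * (E22 - E21 - E12 + E11) - (r21 - r11) * (E12 - E11))"
proof -
  have "S * (r11 * (E22 - E21 - E12 + E11) - (r21 - r11) * (E12 - E11))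
    = r11 * (S * E22 - S * E21) - r21 * (S * E12 - S * E11)" by (simp add: algebra_simps)
  also have "\<dots> = d * (r11 * (r22 - r21 - r12 + r11) - (r21 - r11) * (r12 - r11))"
    unfolding assms[symmetric] by (simp add: algebra_simps)
  finally show ?thesis by simp
qed

text \<open>What a geodesic family provides on a coordinate box: \<open>V a b\<close> is the
  velocity of the chosen geodesic from \<open>a\<close> to \<open>b\<close>, and the Ivory property
  is stated for squared lengths. Positions are needed only at the ends, where they are
  \<open>a\<close> and \<open>b\<close>.\<close>

locale ivory_box = surface +
  fixes I J :: "real set" and V :: "pt \<Rightarrow> pt \<Rightarrow> real \<Rightarrow> pt" and c :: real
  assumes I: "open I" "convex I" and J: "open J" "convex J"
    and box: "I \<times> J \<subseteq> \<Omega>"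
    and approx: "\<And>a b t. a \<in> I \<times> J \<Longrightarrow> b \<in> I \<times> J \<Longrightarrow> t \<in> {0..1} \<Longrightarrow> norm (V a b t - (b - a)) \<le> c * (norm (b - a))\<^sup>2"
    and variation: "\<And>a b a' b'. a \<in> I \<times> J \<Longrightarrow> b \<in> I \<times> J \<Longrightarrow> a' \<in> I \<times> J \<Longrightarrow> b' \<in> I \<times> J \<Longrightarrow>
      \<bar>energy a' (V a' b' 0) - energy a (V a b 0) - (2 * ip b (V a b 1) (b' - b) - 2 * ip a (V a b 0) (a' - a))\<bar>
      \<le> c * (norm (a' - a) + norm (b' - b))\<^sup>2"
    and conserved: "\<And>a b. a \<in> I \<times> J \<Longrightarrow> b \<in> I \<times> J \<Longrightarrow> energy b (V a b 1) = energy a (V a b 0)"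
    and ivory: "\<And>u1 u2 v1 v2. u1 \<in> I \<Longrightarrow> u2 \<in> I \<Longrightarrow> v1 \<in> J \<Longrightarrow> v2 \<in> J \<Longrightarrow> u1 < u2 \<Longrightarrow> v1 < v2 \<Longrightarrow>
      energy (u1, v1) (V (u1, v1) (u2, v2) 0) = energy (u1, v2) (V (u1, v2) (u2, v1) 0)"
begin

section \<open>Leading terms of short diagonals and the vanishing of \<open>F\<close>\<close>

lemma eventually_shift:
  assumes "u \<in> S" "open S"
  shows "\<forall>\<^sub>F s in at_right 0. u + s * \<alpha> \<in> (S :: real set)"
  by (rule topological_tendstoD[OF _ assms(2), where l = u]) (auto intro!: tendsto_eq_intros assms)

text \<open>The velocity differs from the chord \<open>s *\<^sub>R d\<close> by
  \<open>O(s\<^sup>2)\<close>, so after division by \<open>s\<close> only \<open>d\<close>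
  survives.\<close>

lemma velocity_limit:
  assumes ev: "\<forall>\<^sub>F s in at_right 0. a s \<in> I \<times> J \<and> b s \<in> I \<times> J \<and> b s - a s = s *\<^sub>R d" and t: "t \<in> {0..1}"
  shows "((\<lambda>s. V (a s) (b s) t /\<^sub>R s) \<longlongrightarrow> d) (at_right 0)"
proof (rule LIM_zero_cancel, rule Lim_null_comparison)
  show "((\<lambda>s. c * (norm d)\<^sup>2 * s) \<longlongrightarrow> 0) (at_right 0)" by (auto intro!: tendsto_eq_intros)
  show "\<forall>\<^sub>F s in at_right 0. norm (V (a s) (b s) t /\<^sub>R s - d) \<le> c * (norm d)\<^sup>2 * s"
    using ev eventually_at_right_less[of 0]
  proof eventually_elim
    case (elim s)
    have "V (a s) (b s) t /\<^sub>R s - d = (V (a s) (b s) t - (b s - a s)) /\<^sub>R s"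
      using elim by (simp add: scaleR_diff_right)
    then have "norm (V (a s) (b s) t /\<^sub>R s - d) = norm (V (a s) (b s) t - (b s - a s)) / s"
      using elim by (simp add: divide_inverse)
    also have "\<dots> \<le> c * (norm (b s - a s))\<^sup>2 / s"
      using elim t by (intro divide_right_mono approx) auto
    also have "\<dots> = c * (norm d)\<^sup>2 * s" using elim by (simp add: power2_eq_square)
    finally show ?case .
  qed
qed

lemma coeff_continuous:
  assumes "smooth_fun_on \<Omega> f" "q \<in> \<Omega>" shows "isCont f q"
  using smooth_fun_onD(4)[OF assms(1)] open_\<Omega> assms(2) by (simp add: continuous_on_eq_continuous_at)

lemma energy_limit:
  assumes ev: "\<forall>\<^sub>F s in at_right 0. a s \<in> I \<times> J \<and> b s \<in> I \<times> J \<and> b s - a s = s *\<^sub>R d" and t: "t \<in> {0..1}"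
    and a: "(a \<longlongrightarrow> q) (at_right 0)" "q \<in> I \<times> J"
  shows "((\<lambda>s. energy (a s) (V (a s) (b s) t) / s\<^sup>2) \<longlongrightarrow> energy q d) (at_right 0)"
proof -
  have q: "q \<in> \<Omega>" using a(2) box by auto
  note L = velocity_limit[OF ev t]
  have "((\<lambda>s. energy (a s) (V (a s) (b s) t /\<^sub>R s)) \<longlongrightarrow> energy q d) (at_right 0)"
    unfolding energy_def
    by (intro tendsto_intros L isCont_tendsto_compose[OF coeff_continuous[OF smooth(1) q]] a
        isCont_tendsto_compose[OF coeff_continuous[OF smooth(2) q]]
        isCont_tendsto_compose[OF coeff_continuous[OF smooth(3) q]])
  \<comment> \<open>Energy is homogeneous of degree two in the velocity, so scaling the velocity by
    \<open>1 / s\<close> divides it by \<open>s\<^sup>2\<close>.\<close>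
  moreover have "\<forall>\<^sub>F s in at_right 0. energy (a s) (V (a s) (b s) t /\<^sub>R s) = energy (a s) (V (a s) (b s) t) / s\<^sup>2"
    using eventually_at_right_less[of 0]
    by eventually_elim (simp add: energy_def power2_eq_square field_simps)
  ultimately show ?thesis by (rule Lim_transform_eventually)
qed

text \<open>For a coordinate square of side \<open>s\<close> the two squared diagonals are, to
  leading order, \<open>s\<^sup>2\<close> times the energies of \<open>(1, 1)\<close> and
  \<open>(1, -1)\<close>, which differ by \<open>4 * F q\<close>.\<close>

lemma F_zero:
  assumes q: "q \<in> I \<times> J" shows "F q = 0"
proof -
  obtain u v where uv: "q = (u, v)" "u \<in> I" "v \<in> J" using q by auto
  have ev: "\<forall>\<^sub>F s in at_right 0. u + s \<in> I \<and> v + s \<in> J \<and> 0 < s"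
    using eventually_shift[OF uv(2) I(1), of 1] eventually_shift[OF uv(3) J(1), of 1] eventually_at_right_less[of 0]
    by eventually_elim simp
  have L1: "((\<lambda>s. energy (u, v) (V (u, v) (u + s, v + s) 0) / s\<^sup>2) \<longlongrightarrow> energy q (1, 1)) (at_right 0)"
    by (rule energy_limit) (use ev q uv in \<open>auto elim!: eventually_mono\<close>)
  have L2: "((\<lambda>s. energy (u, v + s) (V (u, v + s) (u + s, v) 0) / s\<^sup>2) \<longlongrightarrow> energy q (1, -1)) (at_right 0)"
    by (rule energy_limit) (use ev q uv in \<open>auto elim!: eventually_mono intro!: tendsto_eq_intros\<close>)
  have eq: "\<forall>\<^sub>F s in at_right 0. energy (u, v) (V (u, v) (u + s, v + s) 0) / s\<^sup>2
      = energy (u, v + s) (V (u, v + s) (u + s, v) 0) / s\<^sup>2"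
    using ev
  proof eventually_elim
    case (elim s)
    then show ?case using ivory[of u "u + s" v "v + s"] uv by simp
  qed
  have "energy q (1, 1) = energy q (1, -1)"
    by (rule tendsto_unique[OF trivial_limit_at_right_real Lim_transform_eventually[OF L1 eq] L2])
  then show ?thesis by (simp add: energy_def)
qed

section \<open>Equality of the momenta of the two diagonals\<close>

lemma G_pos: "q \<in> \<Omega> \<Longrightarrow> G q > 0"
  using posdef[of q] by (smt (verit) mult_le_0_iff zero_le_power2)

lemma ip_diagonal: "q \<in> I \<times> J \<Longrightarrow> ip q x y = E q * fst x * fst y + G q * snd x * snd y"
  by (simp add: ip_def F_zero)

text \<open>If two geodesics keep equal energies while their endpoints move with velocities
  \<open>x, y\<close> and \<open>x1, y1\<close>, their first variations agree: the difference is
  linear in \<open>s\<close> yet bounded by a multiple of \<open>s\<^sup>2\<close>.\<close>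

lemma variation_eq:
  assumes box: "a \<in> I \<times> J" "b \<in> I \<times> J" "a1 \<in> I \<times> J" "b1 \<in> I \<times> J"
    and ev: "\<forall>\<^sub>F s in at_right 0. a + s *\<^sub>R x \<in> I \<times> J \<and> b + s *\<^sub>R y \<in> I \<times> J \<and> a1 + s *\<^sub>R x1 \<in> I \<times> J \<and> b1 + s *\<^sub>R y1 \<in> I \<times> J
      \<and> energy (a + s *\<^sub>R x) (V (a + s *\<^sub>R x) (b + s *\<^sub>R y) 0) = energy (a1 + s *\<^sub>R x1) (V (a1 + s *\<^sub>R x1) (b1 + s *\<^sub>R y1) 0)"
    and eq: "energy a (V a b 0) = energy a1 (V a1 b1 0)"
  shows "ip b (V a b 1) y - ip a (V a b 0) x = ip b1 (V a1 b1 1) y1 - ip a1 (V a1 b1 0) x1"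
proof -
  define m where "m = ip b (V a b 1) y - ip a (V a b 0) x"
  define m1 where "m1 = ip b1 (V a1 b1 1) y1 - ip a1 (V a1 b1 0) x1"
  have sc: "ip p v (s *\<^sub>R w) = s * ip p v w" for p v w s by (simp add: ip_def algebra_simps)
  have "\<forall>\<^sub>F s in at_right 0. \<bar>s * (2 * m1 - 2 * m)\<bar> \<le> (c * (norm x + norm y)\<^sup>2 + c * (norm x1 + norm y1)\<^sup>2) * s\<^sup>2"
    using ev eventually_at_right_less[of 0]
  proof eventually_elim
    case (elim s)
    let ?S = "energy (a + s *\<^sub>R x) (V (a + s *\<^sub>R x) (b + s *\<^sub>R y) 0)"
    have "\<bar>?S - energy a (V a b 0) - s * (2 * m)\<bar> \<le> c * (norm x + norm y)\<^sup>2 * s\<^sup>2"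
      using variation[of a b "a + s *\<^sub>R x" "b + s *\<^sub>R y"] elim box
      by (simp add: sc m_def algebra_simps power2_eq_square)
    moreover have "\<bar>?S - energy a (V a b 0) - s * (2 * m1)\<bar> \<le> c * (norm x1 + norm y1)\<^sup>2 * s\<^sup>2"
      using variation[of a1 b1 "a1 + s *\<^sub>R x1" "b1 + s *\<^sub>R y1"] elim box eq
      by (simp add: sc m1_def algebra_simps power2_eq_square)
    ultimately show ?case by (simp add: algebra_simps)
  qed
  then have "2 * m1 - 2 * m = 0" by (rule linear_le_quadratic_imp_zero)
  then show ?thesis by (simp add: m_def m1_def)
qed

text \<open>Each equation moves one side of the rectangle. Moving a \<open>u\<close>-side shifts the
  same end, start or finish, of both diagonals. Moving a \<open>v\<close>-side shifts the end of one
  and the start of the other, whence the minus sign.\<close>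

lemma momenta:
  assumes u: "u1 \<in> I" "u2 \<in> I" "u1 < u2" and v: "v1 \<in> J" "v2 \<in> J" "v1 < v2"
  defines "V' \<equiv> V (u1, v1) (u2, v2)" and "W \<equiv> V (u1, v2) (u2, v1)"
  shows "E (u2, v2) * fst (V' 1) = E (u2, v1) * fst (W 1)"
    "E (u1, v1) * fst (V' 0) = E (u1, v2) * fst (W 0)"
    "G (u2, v2) * snd (V' 1) = - G (u1, v2) * snd (W 0)"
    "G (u1, v1) * snd (V' 0) = - G (u2, v1) * snd (W 1)"
proof -
  \<comment> \<open>Small shifts keep the rectangle in the box and nondegenerate, so the Ivory
    identity still holds for it.\<close>
  have ev: "\<forall>\<^sub>F s in at_right 0. u1 + s \<in> I \<and> u2 + s \<in> I \<and> v1 + s \<in> J \<and> v2 + s \<in> J \<and> u1 + s < u2 \<and> v1 + s < v2 \<and> 0 < s"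
    using eventually_shift[OF u(1) I(1), of 1] eventually_shift[OF u(2) I(1), of 1]
      eventually_shift[OF v(1) J(1), of 1] eventually_shift[OF v(2) J(1), of 1]
      eventually_shift[of u1 "{..<u2}" 1] eventually_shift[of v1 "{..<v2}" 1] eventually_at_right_less[of 0]
    using u v by (simp add: eventually_conj_iff)
  note i = ivory[OF u(1,2) v(1,2) u(3) v(3)]
  have "\<forall>\<^sub>F s in at_right 0. u2 + s \<in> I \<and>
      energy (u1, v1) (V (u1, v1) (u2 + s, v2) 0) = energy (u1, v2) (V (u1, v2) (u2 + s, v1) 0)"
    using ev by eventually_elim (use u v in \<open>auto intro!: ivory\<close>)
  then show "E (u2, v2) * fst (V' 1) = E (u2, v1) * fst (W 1)"
    using variation_eq[of "(u1, v1)" "(u2, v2)" "(u1, v2)" "(u2, v1)" "(0, 0)" "(1, 0)" "(0, 0)" "(1, 0)", OF _ _ _ _ _ i] u v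
    by (simp add: V'_def W_def ip_diagonal)
  have "\<forall>\<^sub>F s in at_right 0. u1 + s \<in> I \<and>
      energy (u1 + s, v1) (V (u1 + s, v1) (u2, v2) 0) = energy (u1 + s, v2) (V (u1 + s, v2) (u2, v1) 0)"
    using ev by eventually_elim (use u v in \<open>auto intro!: ivory\<close>)
  then show "E (u1, v1) * fst (V' 0) = E (u1, v2) * fst (W 0)"
    using variation_eq[of "(u1, v1)" "(u2, v2)" "(u1, v2)" "(u2, v1)" "(1, 0)" "(0, 0)" "(1, 0)" "(0, 0)", OF _ _ _ _ _ i] u v
    by (simp add: V'_def W_def ip_diagonal)
  have "\<forall>\<^sub>F s in at_right 0. v2 + s \<in> J \<and>
      energy (u1, v1) (V (u1, v1) (u2, v2 + s) 0) = energy (u1, v2 + s) (V (u1, v2 + s) (u2, v1) 0)"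
    using ev by eventually_elim (use u v in \<open>auto intro!: ivory\<close>)
  then show "G (u2, v2) * snd (V' 1) = - G (u1, v2) * snd (W 0)"
    using variation_eq[of "(u1, v1)" "(u2, v2)" "(u1, v2)" "(u2, v1)" "(0, 0)" "(0, 1)" "(0, 1)" "(0, 0)", OF _ _ _ _ _ i] u v
    by (simp add: V'_def W_def ip_diagonal)
  have "\<forall>\<^sub>F s in at_right 0. v1 + s \<in> J \<and>
      energy (u1, v1 + s) (V (u1, v1 + s) (u2, v2) 0) = energy (u1, v2) (V (u1, v2) (u2, v1 + s) 0)"
    using ev by eventually_elim (use u v in \<open>auto intro!: ivory\<close>)
  then show "G (u1, v1) * snd (V' 0) = - G (u2, v1) * snd (W 1)"
    using variation_eq[of "(u1, v1)" "(u2, v2)" "(u1, v2)" "(u2, v1)" "(0, 1)" "(0, 0)" "(0, 0)" "(0, 1)", OF _ _ _ _ _ i] u v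
    by (simp add: V'_def W_def ip_diagonal)
qed

section \<open>Differential equations for \<open>E\<close> and \<open>\<rho> = E / G\<close>\<close>

abbreviation "Euv \<equiv> pdiff 0 Ev"
abbreviation "Guv \<equiv> pdiff 0 Gv"

definition "\<rho> q = E q / G q"
definition "\<rho>u q = (Eu q * G q - E q * Gu q) / (G q * G q)"
definition "\<rho>v q = (Ev q * G q - E q * Gv q) / (G q * G q)"
definition "\<rho>uv q = ((Euv q * G q + Ev q * Gu q - (Eu q * Gv q + E q * Guv q)) * (G q * G q)
  - (Ev q * G q - E q * Gv q) * (Gu q * G q + G q * Gu q)) / ((G q * G q) * (G q * G q))"

lemma partial_derivative:
  assumes "smooth_fun_on \<Omega> f" "(u, v) \<in> \<Omega>"
  shows "((\<lambda>w. f (w, v)) has_real_derivative pdiff 0 f (u, v)) (at u)"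
    and "((\<lambda>w. f (u, w)) has_real_derivative pdiff (Suc 0) f (u, v)) (at v)"
proof -
  have "((\<lambda>w. (w, v)) has_vector_derivative (1, 0)) (at u)" "((\<lambda>w. (u, w)) has_vector_derivative (0, 1)) (at v)"
    by (auto intro!: derivative_eq_intros)
  then show "((\<lambda>w. f (w, v)) has_real_derivative pdiff 0 f (u, v)) (at u)"
    and "((\<lambda>w. f (u, w)) has_real_derivative pdiff (Suc 0) f (u, v)) (at v)"
    using pdiff_chain[OF open_\<Omega> smooth_fun_onD(1)[OF assms(1)]] assms(2) by fastforce+
qed

lemma \<rho>_derivatives:
  assumes "u \<in> I" "v \<in> J"
  shows "((\<lambda>w. \<rho> (w, v)) has_real_derivative \<rho>u (u, v)) (at u)"
    and "((\<lambda>w. \<rho> (u, w)) has_real_derivative \<rho>v (u, v)) (at v)"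
    and "((\<lambda>w. \<rho>v (w, v)) has_real_derivative \<rho>uv (u, v)) (at u)"
proof -
  have q: "(u, v) \<in> \<Omega>" using assms box by auto
  then have G: "G (u, v) \<noteq> 0" using G_pos by fastforce
  note D = partial_derivative[OF smooth(1) q] partial_derivative[OF smooth(3) q]
    partial_derivative(1)[OF smooth_fun_onD(3)[OF smooth(1)] q] partial_derivative(1)[OF smooth_fun_onD(3)[OF smooth(3)] q]
  show "((\<lambda>w. \<rho> (w, v)) has_real_derivative \<rho>u (u, v)) (at u)"
    "((\<lambda>w. \<rho> (u, w)) has_real_derivative \<rho>v (u, v)) (at v)"
    unfolding \<rho>_def \<rho>u_def \<rho>v_def by (rule DERIV_divide D G)+
  have d: "((\<lambda>w. Ev (w, v) * G (w, v) - E (w, v) * Gv (w, v)) has_real_derivative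
    Euv (u, v) * G (u, v) + Ev (u, v) * Gu (u, v) - (Eu (u, v) * Gv (u, v) + E (u, v) * Guv (u, v))) (at u)"
    by (rule derivative_eq_intros D refl)+ simp
  have d': "((\<lambda>w. G (w, v) * G (w, v)) has_real_derivative Gu (u, v) * G (u, v) + G (u, v) * Gu (u, v)) (at u)"
    by (rule derivative_eq_intros D refl)+ simp
  show "((\<lambda>w. \<rho>v (w, v)) has_real_derivative \<rho>uv (u, v)) (at u)"
    unfolding \<rho>v_def \<rho>uv_def by (rule DERIV_divide[OF d d']) (use G in simp)
qed

lemma \<rho>uv_continuous:
  assumes "q \<in> I \<times> J" shows "isCont \<rho>uv q"
proof -
  have q: "q \<in> \<Omega>" using assms box by auto
  then have G: "G q \<noteq> 0" using G_pos by fastforce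
  note s = smooth(1) smooth(3) smooth_fun_onD(2,3)[OF smooth(1)] smooth_fun_onD(2,3)[OF smooth(3)]
    smooth_fun_onD(2)[OF smooth_fun_onD(3)[OF smooth(1)]] smooth_fun_onD(2)[OF smooth_fun_onD(3)[OF smooth(3)]]
  show ?thesis
    unfolding \<rho>uv_def[abs_def]
    by (intro continuous_intros s[THEN coeff_continuous] q) (use G in simp)
qed

lemma diagonal_energy: "q \<in> I \<times> J \<Longrightarrow> energy q x = E q * (fst x)\<^sup>2 + G q * (snd x)\<^sup>2"
  by (simp add: energy_def F_zero)

text \<open>Multiplying the energy by \<open>E q\<close> expresses it through the squared momenta,
  which \<open>momenta\<close> compares between corners.\<close>

lemma diagonal_energy_momenta:
  assumes "q \<in> I \<times> J"
  shows "energy q x * E q = (E q * fst x)\<^sup>2 + (G q * snd x)\<^sup>2 * \<rho> q"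
proof -
  have "G q \<noteq> 0" using assms box G_pos by fastforce
  then show ?thesis
    by (simp add: diagonal_energy[OF assms] \<rho>_def power2_eq_square algebra_simps)
qed

text \<open>All four corners carry the same energy \<open>S\<close>, by conservation along each
  diagonal and the Ivory identity between them. Squaring removes the signs in
  \<open>momenta\<close>, so four squared momenta, one per side, suffice for
  \<open>corner_relation\<close>.\<close>

lemma rectangle_relation:
  assumes u: "u1 \<in> I" "u2 \<in> I" "u1 < u2" and v: "v1 \<in> J" "v2 \<in> J" "v1 < v2"
  defines "S \<equiv> energy (u1, v1) (V (u1, v1) (u2, v2) 0)"
    and "d \<equiv> (G (u2, v2) * snd (V (u1, v1) (u2, v2) 1))\<^sup>2"
  shows "d * (\<rho> (u1, v1) * (\<rho> (u2, v2) - \<rho> (u2, v1) - \<rho> (u1, v2) + \<rho> (u1, v1))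
      - (\<rho> (u2, v1) - \<rho> (u1, v1)) * (\<rho> (u1, v2) - \<rho> (u1, v1)))
    = S * (\<rho> (u1, v1) * (E (u2, v2) - E (u2, v1) - E (u1, v2) + E (u1, v1))
      - (\<rho> (u2, v1) - \<rho> (u1, v1)) * (E (u1, v2) - E (u1, v1)))"
proof (rule corner_relation)
  let ?V = "V (u1, v1) (u2, v2)" and ?W = "V (u1, v2) (u2, v1)"
  note m = momenta[OF u v]
  have S: "energy (u1, v1) (?V 0) = S" "energy (u2, v2) (?V 1) = S" "energy (u1, v2) (?W 0) = S" "energy (u2, v1) (?W 1) = S"
    using conserved[of "(u1, v1)" "(u2, v2)"] conserved[of "(u1, v2)" "(u2, v1)"] ivory[OF u(1,2) v(1,2) u(3) v(3)] u v
    by (simp_all add: S_def)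
  show "(E (u1, v1) * fst (?V 0))\<^sup>2 + (G (u1, v1) * snd (?V 0))\<^sup>2 * \<rho> (u1, v1) = S * E (u1, v1)"
    using diagonal_energy_momenta[of "(u1, v1)" "?V 0"] S u v by simp
  show "(E (u2, v2) * fst (?V 1))\<^sup>2 + d * \<rho> (u2, v2) = S * E (u2, v2)"
    using diagonal_energy_momenta[of "(u2, v2)" "?V 1"] S u v by (simp add: d_def)
  show "(E (u1, v1) * fst (?V 0))\<^sup>2 + d * \<rho> (u1, v2) = S * E (u1, v2)"
    using diagonal_energy_momenta[of "(u1, v2)" "?W 0"] S u v by (simp add: d_def m)
  show "(E (u2, v2) * fst (?V 1))\<^sup>2 + (G (u1, v1) * snd (?V 0))\<^sup>2 * \<rho> (u2, v1) = S * E (u2, v1)"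
    using diagonal_energy_momenta[of "(u2, v1)" "?W 1"] S u v by (simp add: m)
qed

lemma difference_quotient_limit:
  assumes "(f has_real_derivative D) (at u)"
  shows "((\<lambda>s. (f (u + s * \<alpha>) - f u) / s) \<longlongrightarrow> D * \<alpha>) (at_right 0)"
proof -
  have "((\<lambda>s. f (u + s * \<alpha>)) has_real_derivative D * \<alpha>) (at 0)"
    by (rule DERIV_chain2[where f = f and g = "\<lambda>s. u + s * \<alpha>"]) (use assms in \<open>auto intro!: derivative_eq_intros\<close>)
  then have "((\<lambda>s. (f (u + s * \<alpha>) - f u) / s) \<longlongrightarrow> D * \<alpha>) (at 0)"
    by (simp add: has_field_derivative_iff)
  then show ?thesis by (rule tendsto_within_subset) simp
qed

text \<open>The relation for the rectangle with sides \<open>s * \<alpha>\<close> and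
  \<open>s\<close>, divided by \<open>s ^ 4\<close>: two powers go to the squared momentum or
  squared length, two to the bracket of differences.\<close>

lemma limit_relation:
  assumes uv: "u \<in> I" "v \<in> J" and \<alpha>: "\<alpha> > 0"
  defines "q \<equiv> (u, v)"
  shows "(G q)\<^sup>2 * (\<rho> q * \<rho>uv q - \<rho>u q * \<rho>v q) = (E q * \<alpha>\<^sup>2 + G q) * (\<rho> q * Euv q - \<rho>u q * Ev q)"
proof -
  let ?u = "\<lambda>s. u + s * \<alpha>" and ?v = "\<lambda>s. v + s"
  have q: "q \<in> I \<times> J" "q \<in> \<Omega>" using uv box by (auto simp: q_def)
  have ev: "\<forall>\<^sub>F s in at_right 0. ?u s \<in> I \<and> ?v s \<in> J \<and> 0 < s"
    using eventually_shift[OF uv(1) I(1), of \<alpha>] eventually_shift[OF uv(2) J(1), of 1] eventually_at_right_less[of 0]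
    by eventually_elim simp
  have ev': "\<forall>\<^sub>F s in at_right 0. q \<in> I \<times> J \<and> (?u s, ?v s) \<in> I \<times> J \<and> (?u s, ?v s) - q = s *\<^sub>R (\<alpha>, 1)"
    using ev by eventually_elim (use uv in \<open>auto simp: q_def\<close>)
  have S: "((\<lambda>s. energy q (V q (?u s, ?v s) 0) / s\<^sup>2) \<longlongrightarrow> E q * \<alpha>\<^sup>2 + G q) (at_right 0)"
    using energy_limit[OF ev' _ tendsto_const q(1), of 0] diagonal_energy[OF q(1), of "(\<alpha>, 1)"] by simp
  have lim: "((\<lambda>s. (?u s, ?v s)) \<longlongrightarrow> q) (at_right 0)"
    unfolding q_def by (auto intro!: tendsto_eq_intros)
  \<comment> \<open>The rescaled final velocity tends to \<open>(\<alpha>, 1)\<close>, so the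
    rescaled \<open>v\<close>-momentum tends to \<open>G q\<close>.\<close>
  have "((\<lambda>s. (G (?u s, ?v s) * snd (V q (?u s, ?v s) 1 /\<^sub>R s))\<^sup>2) \<longlongrightarrow> (G q * snd (\<alpha>, 1::real))\<^sup>2) (at_right 0)"
    by (intro tendsto_intros velocity_limit[OF ev'] isCont_tendsto_compose[OF coeff_continuous[OF smooth(3) q(2)] lim]) simp
  then have d: "((\<lambda>s. (G (?u s, ?v s) * snd (V q (?u s, ?v s) 1))\<^sup>2 / s\<^sup>2) \<longlongrightarrow> (G q)\<^sup>2) (at_right 0)"
    by (simp add: power_mult_distrib power_inverse divide_inverse mult_ac)
  have mix: "((\<lambda>s. (f (?u s, ?v s) - f (?u s, v) - f (u, ?v s) + f (u, v)) / s\<^sup>2) \<longlongrightarrow> \<alpha> * fuv q) (at_right 0)"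
    if "\<And>u v. u \<in> I \<Longrightarrow> v \<in> J \<Longrightarrow> ((\<lambda>w. f (u, w)) has_real_derivative fv (u, v)) (at v)"
      "\<And>u v. u \<in> I \<Longrightarrow> v \<in> J \<Longrightarrow> ((\<lambda>w. fv (w, v)) has_real_derivative fuv (u, v)) (at u)"
      "isCont fuv q" for f fv fuv :: "pt \<Rightarrow> real"
    using mixed_difference_limit[OF I uv(1) J uv(2) \<alpha>, of "\<lambda>x y. f (x, y)" "\<lambda>x y. fv (x, y)" "\<lambda>x y. fuv (x, y)"] that
    by (simp add: q_def)
  have in\<Omega>: "(x, y) \<in> \<Omega>" if "x \<in> I" "y \<in> J" for x y using that box by auto
  have m\<rho>: "((\<lambda>s. (\<rho> (?u s, ?v s) - \<rho> (?u s, v) - \<rho> (u, ?v s) + \<rho> (u, v)) / s\<^sup>2) \<longlongrightarrow> \<alpha> * \<rho>uv q) (at_right 0)"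
    by (rule mix[of \<rho> \<rho>v]) (intro \<rho>_derivatives \<rho>uv_continuous q; assumption)+
  have mE: "((\<lambda>s. (E (?u s, ?v s) - E (?u s, v) - E (u, ?v s) + E (u, v)) / s\<^sup>2) \<longlongrightarrow> \<alpha> * Euv q) (at_right 0)"
    by (rule mix[of E Ev]) (intro partial_derivative smooth smooth_fun_onD in\<Omega> coeff_continuous q; assumption)+
  have d1: "((\<lambda>s. (\<rho> (?u s, v) - \<rho> (u, v)) / s) \<longlongrightarrow> \<rho>u q * \<alpha>) (at_right 0)"
    unfolding q_def by (rule difference_quotient_limit[OF \<rho>_derivatives(1)[OF uv]])
  have d2: "((\<lambda>s. (\<rho> (u, ?v s) - \<rho> (u, v)) / s) \<longlongrightarrow> \<rho>v q) (at_right 0)"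
    using difference_quotient_limit[OF \<rho>_derivatives(2)[OF uv], of 1] by (simp add: q_def)
  have d3: "((\<lambda>s. (E (u, ?v s) - E (u, v)) / s) \<longlongrightarrow> Ev q) (at_right 0)"
    using difference_quotient_limit[OF partial_derivative(2)[OF smooth(1)], of u v 1] q by (simp add: q_def)
  define L where "L s = (G (?u s, ?v s) * snd (V q (?u s, ?v s) 1))\<^sup>2 / s\<^sup>2
      * (\<rho> q * ((\<rho> (?u s, ?v s) - \<rho> (?u s, v) - \<rho> (u, ?v s) + \<rho> (u, v)) / s\<^sup>2)
        - (\<rho> (?u s, v) - \<rho> (u, v)) / s * ((\<rho> (u, ?v s) - \<rho> (u, v)) / s))" for s
  define R where "R s = energy q (V q (?u s, ?v s) 0) / s\<^sup>2
      * (\<rho> q * ((E (?u s, ?v s) - E (?u s, v) - E (u, ?v s) + E (u, v)) / s\<^sup>2)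
        - (\<rho> (?u s, v) - \<rho> (u, v)) / s * ((E (u, ?v s) - E (u, v)) / s))" for s
  have L: "(L \<longlongrightarrow> (G q)\<^sup>2 * (\<rho> q * (\<alpha> * \<rho>uv q) - \<rho>u q * \<alpha> * \<rho>v q)) (at_right 0)"
    unfolding L_def[abs_def] by (intro tendsto_intros d m\<rho> d1 d2)
  have R: "(R \<longlongrightarrow> (E q * \<alpha>\<^sup>2 + G q) * (\<rho> q * (\<alpha> * Euv q) - \<rho>u q * \<alpha> * Ev q)) (at_right 0)"
    unfolding R_def[abs_def] by (intro tendsto_intros S mE d1 d3)
  have eq: "\<forall>\<^sub>F s in at_right 0. L s = R s"
    using ev
  proof eventually_elim
    case (elim s)
    have scale: "x / s\<^sup>2 * (y * (z / s\<^sup>2) - a / s * (b / s)) = x * (y * z - a * b) / (s\<^sup>2 * s\<^sup>2)" for x y z a b :: real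
      using elim by (simp add: field_simps power2_eq_square)
    have "u < ?u s" "v < ?v s" using elim \<alpha> by auto
    then show ?case
      unfolding L_def R_def scale
      using rectangle_relation[of u "?u s" v "?v s"] elim uv by (simp add: q_def)
  qed
  have "(G q)\<^sup>2 * (\<rho> q * (\<alpha> * \<rho>uv q) - \<rho>u q * \<alpha> * \<rho>v q) = (E q * \<alpha>\<^sup>2 + G q) * (\<rho> q * (\<alpha> * Euv q) - \<rho>u q * \<alpha> * Ev q)"
    by (rule tendsto_unique[OF trivial_limit_at_right_real Lim_transform_eventually[OF L eq] R])
  \<comment> \<open>Second differences and products of first differences each carry one factor
    \<open>\<alpha>\<close>, the length ratio of the \<open>u\<close>-side, which cancels.\<close>
  then have "\<alpha> * ((G q)\<^sup>2 * (\<rho> q * \<rho>uv q - \<rho>u q * \<rho>v q)) = \<alpha> * ((E q * \<alpha>\<^sup>2 + G q) * (\<rho> q * Euv q - \<rho>u q * Ev q))"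
    by (simp add: algebra_simps)
  then show ?thesis using \<alpha> by simp
qed

text \<open>Only the factor \<open>E * \<alpha>\<^sup>2 + G\<close> depends on the shape of the
  rectangle. Comparing \<open>\<alpha> = 1\<close> with \<open>\<alpha> = 2\<close> gives
  \<open>3 * E * y = 0\<close>, hence \<open>y = 0\<close>, and then \<open>x = 0\<close>.\<close>

lemma pde:
  assumes "u \<in> I" "v \<in> J"
  shows "\<rho> (u, v) * \<rho>uv (u, v) = \<rho>u (u, v) * \<rho>v (u, v)" "\<rho> (u, v) * Euv (u, v) = \<rho>u (u, v) * Ev (u, v)"
proof -
  let ?q = "(u, v)"
  define x where "x = \<rho> ?q * \<rho>uv ?q - \<rho>u ?q * \<rho>v ?q"
  define y where "y = \<rho> ?q * Euv ?q - \<rho>u ?q * Ev ?q"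
  have q: "?q \<in> \<Omega>" using assms box by auto
  have 1: "(G ?q)\<^sup>2 * x = (E ?q + G ?q) * y" and 2: "(G ?q)\<^sup>2 * x = (E ?q * 4 + G ?q) * y"
    using limit_relation[OF assms, of 1] limit_relation[OF assms, of 2] by (simp_all add: x_def y_def)
  have "E ?q * y = 0" using 1 2 by (simp add: algebra_simps)
  then have y: "y = 0" using posdef[OF q] by simp
  then have "x = 0" using 1 G_pos[OF q] by simp
  with y show "\<rho> ?q * \<rho>uv ?q = \<rho>u ?q * \<rho>v ?q" "\<rho> ?q * Euv ?q = \<rho>u ?q * Ev ?q"
    by (simp_all add: x_def y_def)
qed

text \<open>\<open>separation\<close> with \<open>e = E\<close>; the second factorisation is the one
  of \<open>G\<close> because \<open>E / \<rho> = G\<close>.\<close>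

lemma liouville:
  assumes "I \<noteq> {}" "J \<noteq> {}"
  shows "\<exists>U1 U2 V1 V2. \<forall>q\<in>I \<times> J. E q = (U1 (fst q) - V1 (snd q)) * U2 (fst q) \<and> F q = 0 \<and>
    G q = (U1 (fst q) - V1 (snd q)) * V2 (snd q)"
proof -
  obtain u0 v0 where uv0: "u0 \<in> I" "v0 \<in> J" using assms by auto
  have in\<Omega>: "(x, y) \<in> \<Omega>" if "x \<in> I" "y \<in> J" for x y using that box by auto
  have "\<exists>U1 U2 V1 V2. \<forall>u\<in>I. \<forall>v\<in>J. E (u, v) = (U1 u - V1 v) * U2 u \<and> E (u, v) / \<rho> (u, v) = (U1 u - V1 v) * V2 v"
  proof (rule separation[OF I(2) uv0(1) J(2) uv0(2), where e = "\<lambda>u v. E (u, v)" and \<rho> = "\<lambda>u v. \<rho> (u, v)"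
        and e\<^sub>v = "\<lambda>u v. Ev (u, v)" and e\<^sub>u\<^sub>v = "\<lambda>u v. Euv (u, v)" and \<rho>\<^sub>u = "\<lambda>u v. \<rho>u (u, v)"
        and \<rho>\<^sub>v = "\<lambda>u v. \<rho>v (u, v)" and \<rho>\<^sub>u\<^sub>v = "\<lambda>u v. \<rho>uv (u, v)"])
    show "\<rho> (u, v) > 0" if "u \<in> I" "v \<in> J" for u v
      using posdef[OF in\<Omega>[OF that]] G_pos[OF in\<Omega>[OF that]] by (simp add: \<rho>_def)
  qed (intro \<rho>_derivatives pde partial_derivative smooth smooth_fun_onD in\<Omega>; assumption)+
  moreover have "E (u, v) / \<rho> (u, v) = G (u, v)" if "u \<in> I" "v \<in> J" for u v
    using posdef[OF in\<Omega>[OF that]] G_pos[OF in\<Omega>[OF that]] by (simp add: \<rho>_def)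
  ultimately have "\<exists>U1 U2 V1 V2. \<forall>u\<in>I. \<forall>v\<in>J. E (u, v) = (U1 u - V1 v) * U2 u \<and> G (u, v) = (U1 u - V1 v) * V2 v"
    by simp
  then obtain U1 U2 V1 V2 where "\<forall>u\<in>I. \<forall>v\<in>J. E (u, v) = (U1 u - V1 v) * U2 u \<and> G (u, v) = (U1 u - V1 v) * V2 v"
    by blast
  then show ?thesis using F_zero
    by (intro exI[of _ U1] exI[of _ U2] exI[of _ V1] exI[of _ V2]) auto
qed

end

section \<open>Reduction to a small coordinate box around each point\<close>

theorem mainTheorem7:
  fixes \<Omega> :: "pt set" and E F G :: "pt \<Rightarrow> real"
  assumes domain: "open \<Omega>" "connected \<Omega>"
    and smooth: "smooth_fun_on \<Omega> E" "smooth_fun_on \<Omega> F" "smooth_fun_on \<Omega> G"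
    and posdef: "\<And>p. p \<in> \<Omega> \<Longrightarrow> E p > 0 \<and> E p * G p - (F p)^2 > 0"
    and ivory: "\<And>p. p \<in> \<Omega> \<Longrightarrow> \<exists>\<epsilon>>0. ball p \<epsilon> \<subseteq> \<Omega> \<and>
       (\<forall>u1 u2 v1 v2 \<gamma>1 \<gamma>2. u1 < u2 \<and> v1 < v2 \<and> {u1..u2} \<times> {v1..v2} \<subseteq> ball p \<epsilon> \<and>
          geodesic E F G \<gamma>1 \<and> \<gamma>1 ` {0..1} \<subseteq> ball p \<epsilon> \<and> \<gamma>1 0 = (u1, v1) \<and> \<gamma>1 1 = (u2, v2) \<and>
          geodesic E F G \<gamma>2 \<and> \<gamma>2 ` {0..1} \<subseteq> ball p \<epsilon> \<and> \<gamma>2 0 = (u1, v2) \<and> \<gamma>2 1 = (u2, v1)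
          \<longrightarrow> curve_length E F G \<gamma>1 = curve_length E F G \<gamma>2)"
  shows "\<forall>p\<in>\<Omega>. \<exists>W. open W \<and> p \<in> W \<and> W \<subseteq> \<Omega> \<and>
           (\<exists>U1 U2 V1 V2 :: real \<Rightarrow> real. \<forall>q\<in>W.
              E q = (U1 (fst q) - V1 (snd q)) * U2 (fst q) \<and>
              F q = 0 \<and>
              G q = (U1 (fst q) - V1 (snd q)) * V2 (snd q))"
proof
  fix p assume p: "p \<in> \<Omega>"
  interpret surface \<Omega> E F G
    by (rule surface.intro[OF domain(1) smooth posdef])
  obtain \<epsilon> where \<epsilon>: "\<epsilon> > 0" "ball p \<epsilon> \<subseteq> \<Omega>" and
    iv: "\<forall>u1 u2 v1 v2 \<gamma>1 \<gamma>2. u1 < u2 \<and> v1 < v2 \<and> {u1..u2} \<times> {v1..v2} \<subseteq> ball p \<epsilon> \<and>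
      geodesic E F G \<gamma>1 \<and> \<gamma>1 ` {0..1} \<subseteq> ball p \<epsilon> \<and> \<gamma>1 0 = (u1, v1) \<and> \<gamma>1 1 = (u2, v2) \<and>
      geodesic E F G \<gamma>2 \<and> \<gamma>2 ` {0..1} \<subseteq> ball p \<epsilon> \<and> \<gamma>2 0 = (u1, v2) \<and> \<gamma>2 1 = (u2, v1)
      \<longrightarrow> curve_length E F G \<gamma>1 = curve_length E F G \<gamma>2"
    using ivory[OF p] by (elim exE conjE) (rule that)
  \<comment> \<open>Halving the radius gives a closed ball inside \<open>\<Omega>\<close>, as the
    geodesic family requires, while its curves remain in the ball where the Ivory hypothesis
    speaks.\<close>
  have r: "\<epsilon> / 2 > 0" "cball p (\<epsilon> / 2) \<subseteq> \<Omega>" and half: "ball p (\<epsilon> / 2) \<subseteq> ball p \<epsilon>"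
    using \<epsilon> by (auto simp: subset_iff)
  obtain h c X V where h: "h > 0"
    and geo: "\<And>a b. a \<in> ball p h \<Longrightarrow> b \<in> ball p h \<Longrightarrow> \<exists>A. geo_curve (X a b) (V a b) A \<and> continuous_on {0..1} A"
    and ends: "\<And>a b. a \<in> ball p h \<Longrightarrow> b \<in> ball p h \<Longrightarrow> X a b 0 = a \<and> X a b 1 = b \<and> X a b ` {0..1} \<subseteq> ball p (\<epsilon> / 2)"
    and approx: "\<And>a b t. a \<in> ball p h \<Longrightarrow> b \<in> ball p h \<Longrightarrow> t \<in> {0..1} \<Longrightarrow> norm (V a b t - (b - a)) \<le> c * (norm (b - a))\<^sup>2"
    and var: "\<And>a b a' b'. a \<in> ball p h \<Longrightarrow> b \<in> ball p h \<Longrightarrow> a' \<in> ball p h \<Longrightarrow> b' \<in> ball p h \<Longrightarrow>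
      \<bar>energy a' (V a' b' 0) - energy a (V a b 0) - (2 * ip b (V a b 1) (b' - b) - 2 * ip a (V a b 0) (a' - a))\<bar>
      \<le> c * (norm (a' - a) + norm (b' - b))\<^sup>2"
    by (rule geodesic_family[OF r]) (rule that)
  \<comment> \<open>Points of the square with half-side \<open>k\<close> have coordinate distances
    summing to less than \<open>2 * k\<close>, which is at most \<open>h\<close> and at most
    \<open>\<epsilon>\<close>.\<close>
  define k where "k = min h \<epsilon> / 2"
  define I where "I = {fst p - k<..<fst p + k}"
  define J where "J = {snd p - k<..<snd p + k}"
  have k: "k > 0" "2 * k \<le> h" "2 * k \<le> \<epsilon>" using h \<epsilon> by (auto simp: k_def)
  have IJ: "q \<in> ball p (2 * k)" if "q \<in> I \<times> J" for q
  proof -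
    have "dist p q \<le> \<bar>fst p - fst q\<bar> + \<bar>snd p - snd q\<bar>"
      unfolding dist_prod_def dist_real_def by (rule order_trans[OF _ sqrt_sum_squares_le_sum_abs]) simp
    also have "\<dots> < 2 * k" using that by (auto simp: I_def J_def abs_less_iff)
    finally show ?thesis by simp
  qed
  have IJh: "q \<in> ball p h" and IJ\<epsilon>: "q \<in> ball p \<epsilon>" if "q \<in> I \<times> J" for q
    using IJ[OF that] k by auto
  have len: "curve_length E F G (X a b) = sqrt (energy a (V a b 0))" "geodesic E F G (X a b)"
      "energy b (V a b 1) = energy a (V a b 0)" "energy a (V a b 0) \<ge> 0"
    if ab: "a \<in> I \<times> J" "b \<in> I \<times> J" for a b
  proof -
    note ab' = IJh[OF ab(1)] IJh[OF ab(2)]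
    obtain A where A: "geo_curve (X a b) (V a b) A" "continuous_on {0..1} A" using geo[OF ab'] by blast
    show "curve_length E F G (X a b) = sqrt (energy a (V a b 0))" using curve_length_geo[OF A(1)] ends[OF ab'] by simp
    show "geodesic E F G (X a b)" by (rule geo_curve_geodesic[OF A])
    show "energy b (V a b 1) = energy a (V a b 0)" using energy_constant[OF A(1), of 1 0] ends[OF ab'] by simp
    show "energy a (V a b 0) \<ge> 0" using energy_nonneg IJ\<epsilon>[OF ab(1)] \<epsilon>(2) by blast
  qed
  \<comment> \<open>The hypothesis compares lengths of geodesics in the ball; applied to the two
    curves of the family it becomes an identity of energies, the form used in
    \<open>ivory_box\<close>.\<close>
  have "energy (u1, v1) (V (u1, v1) (u2, v2) 0) = energy (u1, v2) (V (u1, v2) (u2, v1) 0)"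
    if u: "u1 \<in> I" "u2 \<in> I" and v: "v1 \<in> J" "v2 \<in> J" and lt: "u1 < u2" "v1 < v2" for u1 u2 v1 v2
  proof -
    have c: "(u1, v1) \<in> I \<times> J" "(u2, v2) \<in> I \<times> J" "(u1, v2) \<in> I \<times> J" "(u2, v1) \<in> I \<times> J" using u v by auto
    have "{u1..u2} \<times> {v1..v2} \<subseteq> I \<times> J" using u v unfolding I_def J_def by auto
    then have "{u1..u2} \<times> {v1..v2} \<subseteq> ball p \<epsilon>" using IJ\<epsilon> by blast
    then have "curve_length E F G (X (u1, v1) (u2, v2)) = curve_length E F G (X (u1, v2) (u2, v1))"
      using ends[OF IJh[OF c(1)] IJh[OF c(2)]] ends[OF IJh[OF c(3)] IJh[OF c(4)]] half
      by (intro iv[rule_format, of u1 u2 v1 v2] conjI lt len c) auto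
    then show ?thesis using len[OF c(1,2)] len[OF c(3,4)] by simp
  qed
  then interpret ivory_box \<Omega> E F G I J V c
    using approx var len(3) IJh IJ\<epsilon> \<epsilon>(2) surface_axioms
    by (intro ivory_box.intro ivory_box_axioms.intro) (auto simp: I_def J_def)
  have "p \<in> I \<times> J" using k by (cases p) (auto simp: I_def J_def)
  moreover have "I \<noteq> {}" "J \<noteq> {}" using calculation by auto
  ultimately show "\<exists>W. open W \<and> p \<in> W \<and> W \<subseteq> \<Omega> \<and>
           (\<exists>U1 U2 V1 V2 :: real \<Rightarrow> real. \<forall>q\<in>W.
              E q = (U1 (fst q) - V1 (snd q)) * U2 (fst q) \<and>
              F q = 0 \<and>
              G q = (U1 (fst q) - V1 (snd q)) * V2 (snd q))"
    using box liouville open_Times[OF I(1) J(1)] by (intro exI[of _ "I \<times> J"] conjI)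
qed

end
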